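(* There is an $O(m|B'|)$ time algorithm that, given an unweighted directed graph $G=(V,E)$ with $m$ edges and $S\subseteq V$ with $T=V\setminus S$, outputs an estimate $D'$ such that $\tfrac{2}{3}D_{ST}(G)\leq D'\leq D_{ST}(G)$.
   Context: $d(u,v)$ denotes the length of a shortest directed path from $u$ to $v$; $D_{ST}(G)=\max_{s\in S}\max_{t\in T}d(s,t)$. Let $S'$ be the set of vertices of $S$ with an outgoing edge to a vertex of $T$, $T'$ the set of vertices of $T$ with an incoming edge from a vertex of $S$, and $B'=S'\cup T'$. *)

theory Defs
  imports "Graph_Theory.Graph_Theory"
begin

section \<open>Distances and the ST-diameter\<close>

text \<open>
  The library's shortest-walk weight for unit weights; it is infinite if there is
  no directed path from the first to the second vertex.
\<close>

definition dist_in :: "'a pair_pre_digraph \<Rightarrow> 'a \<Rightarrow> 'a \<Rightarrow> ereal" where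
  "dist_in G u v = wf_digraph.\<mu> (with_proj G) (\<lambda>_. 1) u v"

text \<open>Only meaningful for finite nonempty \<open>S\<close> and \<open>T\<close>, as a maximum is taken over both.\<close>

definition ST_diameter :: "'a pair_pre_digraph \<Rightarrow> 'a set \<Rightarrow> 'a set \<Rightarrow> ereal" where
  "ST_diameter G S T = (MAX s\<in>S. MAX t\<in>T. dist_in G s t)"

definition boundary :: "'a pair_pre_digraph \<Rightarrow> 'a set \<Rightarrow> 'a set \<Rightarrow> 'a set" where
  "boundary G S T =
     {s\<in>S. \<exists>t\<in>T. (s, t) \<in> parcs G} \<union> {t\<in>T. \<exists>s\<in>S. (s, t) \<in> parcs G}"


section \<open>Word RAM\<close>

text \<open>
  A unit-cost word RAM with structured control flow. Registers are indexed by naturals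
  (a program mentions only finitely many of them), and there is one random-access memory.
  Every value computed is a \<open>w\<close>-bit word: constants and sums are reduced modulo \<open>2 ^ w\<close>, and
  subtraction truncates at zero. There is deliberately no multiplication, division, shift
  or bitwise instruction, so an upper bound on the running time in this model is also
  one for word RAMs with a richer instruction set.
\<close>

datatype ram_prog =
    Const nat nat                        (* r := k *)
  | Add nat nat nat                      (* r := a + b *)
  | Sub nat nat nat                      (* r := a - b *)
  | Load nat nat                         (* r := mem[a] *)
  | Store nat nat                        (* mem[a] := b *)
  | Seq ram_prog ram_prog
  | IfLess nat nat ram_prog ram_prog     (* if a < b then .. else .. *)
  | WhileLess nat nat ram_prog           (* while a < b do .. *)

type_synonym ram_state = "(nat \<Rightarrow> nat) \<times> (nat \<Rightarrow> nat)"  (* registers, memory *)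

text \<open>
  \<open>ram_exec w p s k s'\<close>: with word length \<open>w\<close>, program \<open>p\<close> started in \<open>s\<close> halts in \<open>s'\<close>
  after exactly \<open>k\<close> steps, where each instruction and each evaluation of a test is one step.
\<close>

inductive ram_exec :: "nat \<Rightarrow> ram_prog \<Rightarrow> ram_state \<Rightarrow> nat \<Rightarrow> ram_state \<Rightarrow> bool" for w where
  "ram_exec w (Const r k) (R, M) 1 (R(r := k mod 2 ^ w), M)"
| "ram_exec w (Add r a b) (R, M) 1 (R(r := (R a + R b) mod 2 ^ w), M)"
| "ram_exec w (Sub r a b) (R, M) 1 (R(r := R a - R b), M)"
| "ram_exec w (Load r a) (R, M) 1 (R(r := M (R a)), M)"
| "ram_exec w (Store a b) (R, M) 1 (R, M(R a := R b))"
| "ram_exec w p s j s' \<Longrightarrow> ram_exec w q s' k s'' \<Longrightarrow> ram_exec w (Seq p q) s (j + k) s''"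
| "R a < R b \<Longrightarrow> ram_exec w p (R, M) k s' \<Longrightarrow> ram_exec w (IfLess a b p q) (R, M) (1 + k) s'"
| "\<not> R a < R b \<Longrightarrow> ram_exec w q (R, M) k s' \<Longrightarrow> ram_exec w (IfLess a b p q) (R, M) (1 + k) s'"
| "\<not> R a < R b \<Longrightarrow> ram_exec w (WhileLess a b p) (R, M) 1 (R, M)"
| "R a < R b \<Longrightarrow> ram_exec w p (R, M) j s' \<Longrightarrow> ram_exec w (WhileLess a b p) s' k s''
     \<Longrightarrow> ram_exec w (WhileLess a b p) (R, M) (1 + j + k) s''"

inductive_cases ram_exec_SeqE: "ram_exec w (Seq p q) s n t"
inductive_cases ram_exec_IfE: "ram_exec w (IfLess a b p q) (R, M) n t"
inductive_cases ram_exec_WhileE: "ram_exec w (WhileLess a b p) (R, M) n t"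

lemma ram_exec_deterministic:
  "ram_exec w p s k t \<Longrightarrow> ram_exec w p s k' t' \<Longrightarrow> k = k' \<and> t = t'"
proof (induction arbitrary: k' t' rule: ram_exec.induct)
  case (6 p s j s' q k s'')
  from 6(5) obtain j1 s1 k1 where "ram_exec w p s j1 s1" "ram_exec w q s1 k1 t'" "k' = j1 + k1"
    by (rule ram_exec_SeqE)
  with 6(3)[of j1 s1] 6(4)[of k1 t'] show ?case by simp
next
  case (7 R a b p M k s' q)
  from 7(4) show ?case by (rule ram_exec_IfE) (use 7(1,3) in auto)
next
  case (8 R a b q M k s' p)
  from 8(4) show ?case by (rule ram_exec_IfE) (use 8(1,3) in auto)
next
  case (9 R a b p M)
  from 9(2) show ?case by (rule ram_exec_WhileE) (use 9(1) in auto)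
next
  case (10 R a b p M j s' k s'')
  from 10(6,1) obtain j1 s1 k1 where "k' = Suc (j1 + k1)" "ram_exec w p (R, M) j1 s1"
    and l: "ram_exec w (WhileLess a b p) s1 k1 t'"
    by (auto elim: ram_exec_WhileE)
  with 10(4)[of j1 s1] have "j = j1" "s' = s1" by auto
  with l 10(5)[of k1 t'] \<open>k' = Suc (j1 + k1)\<close> show ?case by simp
qed (erule ram_exec.cases; simp)+

text \<open>The input is a list of words, placed in memory from address 0; all else is zero.\<close>

definition ram_init :: "nat list \<Rightarrow> ram_state" where
  "ram_init xs = (\<lambda>_. 0, \<lambda>i. if i < length xs then xs ! i else 0)"

text \<open>
  The output is an element of the natural numbers extended by infinity: register 0 holds
  the value, and a nonzero register 1 signals infinity.
\<close>

definition ram_output :: "ram_state \<Rightarrow> ereal" where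
  "ram_output s = (if fst s 1 = 0 then ereal (real (fst s 0)) else \<infinity>)"

text \<open>
  A graph on the vertices \<open>0, \<dots>, n - 1\<close> is given by \<open>n\<close>, the number of edges, the edges
  themselves in the order of the list \<open>es\<close>, and the characteristic vector of \<open>S\<close>.
\<close>

definition encode_input :: "nat \<Rightarrow> (nat \<times> nat) list \<Rightarrow> nat set \<Rightarrow> nat list" where
  "encode_input n es S =
     n # length es # concat (map (\<lambda>(u, v). [u, v]) es) @ map (\<lambda>v. if v \<in> S then 1 else 0) [0..<n]"

end

(*
  Let D be the ST-diameter. Run a breadth-first search from every vertex of S', backwards from
  every vertex of T', and finally from S' as a whole and backwards from T' as a whole. Let mu be
  the largest distance found from a vertex of S' to one of T or from one of S to one of T'; let
  beta = max_t d(S', t) and gamma = max_s d(s, T'). The estimate is max(mu, beta + gamma - 1).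
  It is at most D: a path from the s attaining gamma to the t attaining beta crosses from S to T
  by an edge (u, v), where d(s, v) >= gamma and d(u, t) >= beta. It is at least 2D/3: for all s
  and t, some v in T' has d(v, t) <= beta - 1 and d(s, v) <= mu, so D <= mu + beta - 1 and likewise
  D <= mu + gamma - 1; add the two.

  A search costs O(m + n). If n > 2m, some vertex is isolated and D is infinite; otherwise this is
  O(m), and there are |B'| + 2 searches.
*)
theory Submission
  imports Defs
begin

section \<open>A language of arrays on top of the word RAM\<close>

text \<open>The overview implicitly takes all distances to be finite. Unreachability is harmless: a
  search from a single vertex of S' or T' measures pairs over which D itself is the maximum, so one
  missed vertex already makes D infinite; a search from a whole set misses a vertex only if all its
  members do. If nothing is missed, S' and T' are nonempty, as nothing is reachable from the empty
  set. Adding the two final bounds gives 2D <= 2 mu + beta + gamma - 2, which is less than 3 times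
  the estimate.

  Most of the text concerns the running time, counted on a machine without multiplication whose
  words may overflow. Programs are therefore written over eight arrays spaced by the input length;
  loop-free code is executed by the simplifier, and each loop gets a potential that yields
  termination and step count at once. A search is linear only in an amortised sense: removing a
  vertex costs its out-degree. Backward searches need no second proof, as one locale is instantiated
  twice, with edges reversed and sides exchanged.\<close>

datatype cmd =
    CConst nat nat
  | CAdd nat nat nat
  | CSub nat nat nat
  | CLoad nat nat nat
  | CStore nat nat nat
  | CSeq cmd cmd (infixr ";;" 60)
  | CIf nat nat cmd cmd
  | CWhile nat nat cmd

text \<open>
  Array \<open>j\<close> occupies the addresses from \<open>j * N\<close> on; register \<open>100 + j\<close> holds this base
  address, and register 99 is a scratch register for address computations.
\<close>

primrec compile :: "cmd \<Rightarrow> ram_prog" where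
  "compile (CConst r k) = Const r k"
| "compile (CAdd r a b) = Add r a b"
| "compile (CSub r a b) = Sub r a b"
| "compile (CLoad r j i) = Seq (Add 99 (100 + j) i) (Load r 99)"
| "compile (CStore j i x) = Seq (Add 99 (100 + j) i) (Store 99 x)"
| "compile (c ;; d) = Seq (compile c) (compile d)"
| "compile (CIf a b c d) = IfLess a b (compile c) (compile d)"
| "compile (CWhile a b c) = WhileLess a b (compile c)"

type_synonym array_state = "(nat \<Rightarrow> nat) \<times> (nat \<Rightarrow> nat \<Rightarrow> nat)"

definition represents :: "nat \<Rightarrow> array_state \<Rightarrow> ram_state \<Rightarrow> bool" where
  "represents N s t \<longleftrightarrow>
     (\<forall>r<99. fst t r = fst s r) \<and> (\<forall>j<8. fst t (100 + j) = j * N) \<and>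
     (\<forall>j<8. \<forall>i<N. snd t (j * N + i) = snd s j i)"

primrec cost :: "cmd \<Rightarrow> nat" where
  "cost (CConst r k) = 1"
| "cost (CAdd r a b) = 1"
| "cost (CSub r a b) = 1"
| "cost (CLoad r j i) = 2"
| "cost (CStore j i x) = 2"
| "cost (c ;; d) = cost c + cost d"
| "cost (CIf a b c d) = 1 + max (cost c) (cost d)"
| "cost (CWhile a b c) = 0"

text \<open>
  Weakest preconditions of loop-free commands; they contain the side conditions under which
  no arithmetic overflow and no out-of-bounds access occurs. A loop has the precondition \<open>False\<close>,
  which is why its \<open>cost\<close> above is a dummy value.
\<close>

primrec wp :: "nat \<Rightarrow> nat \<Rightarrow> cmd \<Rightarrow> (array_state \<Rightarrow> bool) \<Rightarrow> array_state \<Rightarrow> bool" where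
  "wp N w (CConst r k) Q s \<longleftrightarrow> r < 99 \<and> k < 2 ^ w \<and> Q ((fst s)(r := k), snd s)"
| "wp N w (CAdd r a b) Q s \<longleftrightarrow> r < 99 \<and> a < 99 \<and> b < 99 \<and> fst s a + fst s b < 2 ^ w \<and>
     Q ((fst s)(r := fst s a + fst s b), snd s)"
| "wp N w (CSub r a b) Q s \<longleftrightarrow> r < 99 \<and> a < 99 \<and> b < 99 \<and>
     Q ((fst s)(r := fst s a - fst s b), snd s)"
| "wp N w (CLoad r j i) Q s \<longleftrightarrow> r < 99 \<and> j < 8 \<and> i < 99 \<and> fst s i < N \<and>
     Q ((fst s)(r := snd s j (fst s i)), snd s)"
| "wp N w (CStore j i x) Q s \<longleftrightarrow> j < 8 \<and> i < 99 \<and> x < 99 \<and> fst s i < N \<and>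
     Q (fst s, (snd s)(j := (snd s j)(fst s i := fst s x)))"
| "wp N w (c ;; d) Q s \<longleftrightarrow> wp N w c (\<lambda>s'. wp N w d Q s') s"
| "wp N w (CIf a b c d) Q s \<longleftrightarrow> a < 99 \<and> b < 99 \<and>
     (fst s a < fst s b \<longrightarrow> wp N w c Q s) \<and> (\<not> fst s a < fst s b \<longrightarrow> wp N w d Q s)"
| "wp N w (CWhile a b c) Q s \<longleftrightarrow> False"

text \<open>
  As a congruence rule, this makes the simplifier execute a command from left to right; otherwise
  it would first expand the postcondition under the binder, which blows up exponentially.
\<close>

lemma wp_cong: "s = s' \<Longrightarrow> wp N w c Q s = wp N w c Q s'"
  by simp

lemma wp_mono: "wp N w c Q s \<Longrightarrow> (\<And>s'. Q s' \<Longrightarrow> Q' s') \<Longrightarrow> wp N w c Q' s"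
proof (induction c arbitrary: Q Q' s)
  case (CSeq c d)
  show ?case
    using CSeq.prems CSeq.IH(1)[of "wp N w d Q" s "wp N w d Q'"] CSeq.IH(2)[of Q _ Q'] by simp
next
  case (CIf a b c d)
  show ?case
    using CIf.prems CIf.IH(1)[of Q s Q'] CIf.IH(2)[of Q s Q'] by simp
qed auto

section \<open>Timed total correctness of compiled commands\<close>

locale array_machine =
  fixes N w :: nat
  assumes no_overflow: "8 * N \<le> 2 ^ w"
begin

text \<open>A timed total-correctness triple. All RAM states representing \<open>s\<close> are
  covered, since the scratch register and the memory outside the arrays are arbitrary; the final
  \<open>s'\<close> is existential because \<open>represents\<close> does not determine an array
  state outside its bounds.\<close>

definition ok :: "cmd \<Rightarrow> nat \<Rightarrow> array_state \<Rightarrow> (array_state \<Rightarrow> bool) \<Rightarrow> bool" where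
  "ok c K s Q \<longleftrightarrow> (\<forall>t. represents N s t \<longrightarrow>
     (\<exists>k s' t'. ram_exec w (compile c) t k t' \<and> k \<le> K \<and> represents N s' t' \<and> Q s'))"

lemma ok_mono:
  assumes "ok c K s Q" and "K \<le> K'" and "\<And>s'. Q s' \<Longrightarrow> Q' s'"
  shows "ok c K' s Q'"
  using assms unfolding ok_def by (meson order_trans)

lemma ok_seq:
  assumes "ok c K s Q" and "\<And>s'. Q s' \<Longrightarrow> ok d L s' Q'"
  shows "ok (c ;; d) (K + L) s Q'"
  unfolding ok_def
proof (intro allI impI)
  fix t assume "represents N s t"
  then obtain k s' t' where 1: "ram_exec w (compile c) t k t'" "k \<le> K" "represents N s' t'" "Q s'"
    using assms(1) unfolding ok_def by blast
  then obtain l s'' t'' where 2: "ram_exec w (compile d) t' l t''" "l \<le> L" "represents N s'' t''" "Q' s''"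
    using assms(2) unfolding ok_def by blast
  have "ram_exec w (compile (c ;; d)) t (k + l) t''"
    using 1 2 by (auto intro: ram_exec.intros)
  with 1 2 show "\<exists>k s' t'. ram_exec w (compile (c ;; d)) t k t' \<and> k \<le> K + L \<and> represents N s' t' \<and> Q' s'"
    by (intro exI[of _ "k + l"] exI[of _ s''] exI[of _ t'']) simp
qed

lemma ok_if:
  assumes "a < 99" "b < 99" and "fst s a < fst s b \<Longrightarrow> ok c K s Q" and "\<not> fst s a < fst s b \<Longrightarrow> ok d K s Q"
  shows "ok (CIf a b c d) (Suc K) s Q"
  unfolding ok_def
proof (intro allI impI)
  fix t assume r: "represents N s t"
  obtain R M where t: "t = (R, M)" by (cases t)
  have eq: "R a = fst s a" "R b = fst s b" using r assms(1,2) by (auto simp: represents_def t)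
  show "\<exists>k s' t'. ram_exec w (compile (CIf a b c d)) t k t' \<and> k \<le> Suc K \<and> represents N s' t' \<and> Q s'"
  proof (cases "R a < R b")
    case True
    then obtain k s' t' where "ram_exec w (compile c) t k t'" "k \<le> K" "represents N s' t'" "Q s'"
      using assms(3) eq r unfolding ok_def by metis
    moreover from this have "ram_exec w (compile (CIf a b c d)) t (1 + k) t'"
      using ram_exec.intros(7)[of R a b w _ M] True t by simp
    ultimately show ?thesis by (intro exI[of _ "1 + k"] exI[of _ s'] exI[of _ t']) simp
  next
    case False
    then obtain k s' t' where "ram_exec w (compile d) t k t'" "k \<le> K" "represents N s' t'" "Q s'"
      using assms(4) eq r unfolding ok_def by metis
    moreover from this have "ram_exec w (compile (CIf a b c d)) t (1 + k) t'"
      using ram_exec.intros(8)[of R a b w _ M] False t by simp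
    ultimately show ?thesis by (intro exI[of _ "1 + k"] exI[of _ s'] exI[of _ t']) simp
  qed
qed

text \<open>An iteration lowers \<open>\<Phi>\<close> by at least its own cost and one step for the
  test, which also gives termination; the final \<open>+ 1\<close> pays for the failing test.
  \<open>K\<close> may depend on the state, so an iteration may be as expensive as the potential it
  releases.\<close>

lemma ok_while:
  assumes ab: "a < 99" "b < 99"
    and body: "\<And>s. I s \<Longrightarrow> fst s a < fst s b \<Longrightarrow> \<exists>K. ok c K s (\<lambda>s'. I s' \<and> K + 1 + \<Phi> s' \<le> \<Phi> s)"
    and "I s"
  shows "ok (CWhile a b c) (\<Phi> s + 1) s (\<lambda>s'. I s' \<and> \<not> fst s' a < fst s' b)"
  using \<open>I s\<close>
proof (induction "\<Phi> s" arbitrary: s rule: less_induct)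
  case less
  show ?case
    unfolding ok_def
  proof (intro allI impI)
    fix t assume r: "represents N s t"
    obtain R M where t: "t = (R, M)" by (cases t)
    have eq: "R a = fst s a" "R b = fst s b" using r ab by (auto simp: represents_def t)
    show "\<exists>k s' t'. ram_exec w (compile (CWhile a b c)) t k t' \<and> k \<le> \<Phi> s + 1 \<and>
      represents N s' t' \<and> I s' \<and> \<not> fst s' a < fst s' b"
    proof (cases "R a < R b")
      case True
      then obtain K where "ok c K s (\<lambda>s'. I s' \<and> K + 1 + \<Phi> s' \<le> \<Phi> s)"
        using body[of s] less.prems eq by auto
      then obtain k s' t' where 1: "ram_exec w (compile c) t k t'" "k \<le> K" "represents N s' t'"
          "I s'" "K + 1 + \<Phi> s' \<le> \<Phi> s"
        using r unfolding ok_def by blast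
      then have "ok (CWhile a b c) (\<Phi> s' + 1) s' (\<lambda>s'. I s' \<and> \<not> fst s' a < fst s' b)"
        using less.hyps[of s'] by auto
      then obtain l s'' t'' where 2: "ram_exec w (compile (CWhile a b c)) t' l t''" "l \<le> \<Phi> s' + 1"
          "represents N s'' t''" "I s''" "\<not> fst s'' a < fst s'' b"
        using 1(3) unfolding ok_def by blast
      have "ram_exec w (compile (CWhile a b c)) t (1 + k + l) t''"
        using 1 2 True ram_exec.intros(10)[of R a b w _ M] by (simp add: t)
      moreover have "1 + k + l \<le> \<Phi> s + 1" using 1 2 by simp
      ultimately show ?thesis using 2 by blast
    next
      case False
      then have "ram_exec w (compile (CWhile a b c)) t 1 t"
        using ram_exec.intros(9)[of R a b w _ M] by (simp add: t)
      then show ?thesis using False eq r less.prems by (intro exI[of _ 1] exI[of _ s] exI[of _ t]) auto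
    qed
  qed
qed

lemma address_less: "j < 8 \<Longrightarrow> i < N \<Longrightarrow> j * N + i < 2 ^ w"
proof -
  assume "j < 8" "i < N"
  then have "(j + 1) * N \<le> 8 * N" by (intro mult_le_mono1) simp
  then have "j * N + N \<le> 2 ^ w" using no_overflow unfolding add_mult_distrib by linarith
  then show ?thesis using \<open>i < N\<close> by linarith
qed

text \<open>Division by \<open>N\<close> recovers the array from the address. Stores rely on this:
  writing one cell leaves all other cells of all arrays untouched.\<close>

lemma address_inj:
  assumes "i < N" "i' < N" "j * N + i = j' * N + i'"
  shows "j = j' \<and> i = i'"
proof -
  have "(j * N + i) div N = j" "(j' * N + i') div N = j'"
    using assms(1,2) by auto
  then show ?thesis using assms(3) by auto
qed

lemma ok_wp: "wp N w c Q s \<Longrightarrow> ok c (cost c) s Q"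
proof (induction c arbitrary: Q s)
  case (CConst r k)
  show ?case
    unfolding ok_def
  proof (intro allI impI)
    fix t assume r: "represents N s t"
    obtain R M where t: "t = (R, M)" by (cases t)
    show "\<exists>k' s' t'. ram_exec w (compile (CConst r k)) t k' t' \<and> k' \<le> cost (CConst r k) \<and> represents N s' t' \<and> Q s'"
      using CConst r ram_exec.intros(1)[of w r k R M]
      by (intro exI[of _ 1] exI[of _ "((fst s)(r := k), snd s)"] exI[of _ "(R(r := k), M)"])
        (auto simp: t represents_def)
  qed
next
  case (CAdd r a b)
  show ?case
    unfolding ok_def
  proof (intro allI impI)
    fix t assume r: "represents N s t"
    obtain R M where t: "t = (R, M)" by (cases t)
    show "\<exists>k' s' t'. ram_exec w (compile (CAdd r a b)) t k' t' \<and> k' \<le> cost (CAdd r a b) \<and> represents N s' t' \<and> Q s'"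
      using CAdd r ram_exec.intros(2)[of w r a b R M]
      by (intro exI[of _ 1] exI[of _ "((fst s)(r := fst s a + fst s b), snd s)"] exI[of _ "(R(r := R a + R b), M)"])
        (auto simp: t represents_def)
  qed
next
  case (CSub r a b)
  show ?case
    unfolding ok_def
  proof (intro allI impI)
    fix t assume r: "represents N s t"
    obtain R M where t: "t = (R, M)" by (cases t)
    show "\<exists>k' s' t'. ram_exec w (compile (CSub r a b)) t k' t' \<and> k' \<le> cost (CSub r a b) \<and> represents N s' t' \<and> Q s'"
      using CSub r ram_exec.intros(3)[of w r a b R M]
      by (intro exI[of _ 1] exI[of _ "((fst s)(r := fst s a - fst s b), snd s)"] exI[of _ "(R(r := R a - R b), M)"])
        (auto simp: t represents_def)
  qed
next
  case (CLoad r j i)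
  show ?case
    unfolding ok_def
  proof (intro allI impI)
    fix t assume r: "represents N s t"
    obtain R M where t: "t = (R, M)" by (cases t)
    let ?a = "j * N + fst s i"
    have lt: "?a < 2 ^ w" using CLoad by (intro address_less) auto
    have eq: "R (100 + j) = j * N" "R i = fst s i" "M ?a = snd s j (fst s i)"
      using r CLoad by (auto simp: t represents_def)
    have "ram_exec w (compile (CLoad r j i)) t (1 + 1) (R(99 := ?a, r := M ?a), M)"
      using ram_exec.intros(2)[of w 99 "100 + j" i R M] ram_exec.intros(4)[of w r 99 "R(99 := ?a)" M]
        eq lt unfolding t compile.simps by (intro ram_exec.intros(6)) (auto simp: add.commute)
    then show "\<exists>k' s' t'. ram_exec w (compile (CLoad r j i)) t k' t' \<and> k' \<le> cost (CLoad r j i) \<and> represents N s' t' \<and> Q s'"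
      using CLoad r eq
      by (intro exI[of _ "1 + 1"] exI[of _ "((fst s)(r := snd s j (fst s i)), snd s)"] exI[of _ "(R(99 := ?a, r := M ?a), M)"])
        (auto simp: t represents_def)
  qed
next
  case (CStore j i x)
  show ?case
    unfolding ok_def
  proof (intro allI impI)
    fix t assume r: "represents N s t"
    obtain R M where t: "t = (R, M)" by (cases t)
    let ?a = "j * N + fst s i"
    let ?s = "(fst s, (snd s)(j := (snd s j)(fst s i := fst s x)))"
    have lt: "?a < 2 ^ w" using CStore by (intro address_less) auto
    have eq: "R (100 + j) = j * N" "R i = fst s i" "R x = fst s x"
      using r CStore by (auto simp: t represents_def)
    \<comment> \<open>The address computation overwrites register 99, so the stored value must not
      live there.\<close>
    have x: "x \<noteq> 99" and i: "j < 8" "fst s i < N" using CStore by auto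
    have "ram_exec w (compile (CStore j i x)) t (1 + 1) (R(99 := ?a), M(?a := fst s x))"
      using ram_exec.intros(2)[of w 99 "100 + j" i R M] ram_exec.intros(5)[of w 99 x "R(99 := ?a)" M]
        eq lt x unfolding t compile.simps by (intro ram_exec.intros(6)) (auto simp: add.commute)
    moreover have "represents N ?s (R(99 := ?a), M(?a := fst s x))"
      using r i address_inj[of _ "fst s i" _ j] by (fastforce simp: t represents_def)
    moreover have "Q ?s" using CStore by simp
    ultimately show "\<exists>k' s' t'. ram_exec w (compile (CStore j i x)) t k' t' \<and> k' \<le> cost (CStore j i x) \<and> represents N s' t' \<and> Q s'"
      by (intro exI[of _ "1 + 1"] exI[of _ ?s] exI[of _ "(R(99 := ?a), M(?a := fst s x))"]) auto
  qed
next
  case (CSeq c d)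
  have "ok c (cost c) s (wp N w d Q)" using CSeq by simp
  then have "ok (c ;; d) (cost c + cost d) s Q" by (rule ok_seq) (rule CSeq.IH)
  then show ?case by simp
next
  case (CIf a b c d)
  have "ok (CIf a b c d) (Suc (max (cost c) (cost d))) s Q"
    using CIf.prems by (intro ok_if) (auto intro!: ok_mono[OF CIf.IH(1)[of Q s]] ok_mono[OF CIf.IH(2)[of Q s]])
  then show ?case by simp
qed simp

lemma ok_wp_seq: "wp N w c (\<lambda>s'. ok d L s' Q) s \<Longrightarrow> ok (c ;; d) (cost c + L) s Q"
  by (rule ok_seq[OF ok_wp])

lemma ok_while_wp:
  assumes "a < 99" "b < 99"
    and "\<And>s. I s \<Longrightarrow> fst s a < fst s b \<Longrightarrow> wp N w c (\<lambda>s'. I s' \<and> cost c + 1 + \<Phi> s' \<le> \<Phi> s) s"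
    and "I s"
  shows "ok (CWhile a b c) (\<Phi> s + 1) s (\<lambda>s'. I s' \<and> \<not> fst s' a < fst s' b)"
  using assms by (intro ok_while) (auto intro!: exI[of _ "cost c"] ok_wp)

text \<open>\<open>wp\<close> is \<open>False\<close> on loops, so assignments in front of a loop
  are peeled off by this rule and the next one.\<close>

lemma ok_const_seq:
  assumes "r < 99" "k < 2 ^ w" "ok d L ((fst s)(r := k), snd s) Q"
  shows "ok (CConst r k ;; d) (1 + L) s Q"
  using ok_wp_seq[of "CConst r k" d L Q s] assms by simp

lemma ok_add_seq:
  assumes "r < 99" "a < 99" "b < 99" "fst s a + fst s b = v" "v < 2 ^ w" "ok d L ((fst s)(r := v), snd s) Q"
  shows "ok (CAdd r a b ;; d) (1 + L) s Q"
  using ok_wp_seq[of "CAdd r a b" d L Q s] assms by simp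

end

section \<open>Breadth-first search\<close>

definition walk_from :: "nat rel \<Rightarrow> nat set \<Rightarrow> nat \<Rightarrow> nat \<Rightarrow> bool" where
  "walk_from E X k v \<longleftrightarrow> (\<exists>x\<in>X. (x, v) \<in> E ^^ k)"

text \<open>The distance plus one, with 0 encoding unreachability.\<close>

definition sdist :: "nat rel \<Rightarrow> nat set \<Rightarrow> nat \<Rightarrow> nat" where
  "sdist E X v = (if \<exists>k. walk_from E X k v then Suc (LEAST k. walk_from E X k v) else 0)"

text \<open>A label is correct as soon as a walk witnesses it and no walk beats it; a finished
  search delivers these two facts.\<close>

lemma sdist_eqI:
  assumes "d \<noteq> 0 \<Longrightarrow> walk_from E X (d - 1) v" and "\<And>k. walk_from E X k v \<Longrightarrow> d \<noteq> 0 \<and> d \<le> Suc k"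
  shows "sdist E X v = d"
proof (cases "d = 0")
  case True
  then show ?thesis using assms(2) by (auto simp: sdist_def)
next
  case False
  then have "(LEAST k. walk_from E X k v) = d - 1"
    using assms by (intro Least_equality) (auto simp: le_diff_conv)
  then show ?thesis using False assms(1) by (auto simp: sdist_def)
qed

lemma sdist_eq_0: "sdist E X v = 0 \<longleftrightarrow> (\<forall>k. \<not> walk_from E X k v)"
  by (auto simp: sdist_def)

lemma sdist_le: "walk_from E X k v \<Longrightarrow> sdist E X v \<le> Suc k"
  by (auto simp: sdist_def intro: Least_le)

lemma sdist_walk: "sdist E X v \<noteq> 0 \<Longrightarrow> walk_from E X (sdist E X v - 1) v"
  unfolding sdist_def by (auto intro: LeastI split: if_splits)

definition edges_of :: "nat \<Rightarrow> (nat \<Rightarrow> nat) \<Rightarrow> (nat \<Rightarrow> nat) \<Rightarrow> nat rel" where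
  "edges_of m src tgt = {(src e, tgt e) | e. e < m}"

text \<open>Edges are numbered from 1 here, so that 0 can stand for the absence of an edge.\<close>

primrec last_edge :: "(nat \<Rightarrow> nat) \<Rightarrow> nat \<Rightarrow> nat \<Rightarrow> nat" where
  "last_edge src u 0 = 0"
| "last_edge src u (Suc e) = (if src e = u then Suc e else last_edge src u e)"

lemma last_edge_le: "last_edge src u p \<le> p"
  by (induction p) auto

text \<open>This is why a jump along the edge list of a vertex overlooks none of its edges.\<close>

lemma last_edge_none: "last_edge src u p \<le> e \<Longrightarrow> e < p \<Longrightarrow> src e \<noteq> u"
  by (induction p) (auto simp: less_Suc_eq split: if_splits)

lemma last_edge_src: "last_edge src u p = Suc e \<Longrightarrow> src e = u"
  by (induction p) (auto split: if_splits)

locale bfs_graph =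
  fixes n m :: nat and src tgt :: "nat \<Rightarrow> nat"
  assumes src_less: "e < m \<Longrightarrow> src e < n" and tgt_less: "e < m \<Longrightarrow> tgt e < n"
begin

abbreviation "E \<equiv> edges_of m src tgt"

text \<open>
  The queue \<open>q\<close> has length \<open>t\<close>, and its first \<open>h\<close> vertices have been removed. Of the edges
  leaving the vertex removed last, exactly those before \<open>p\<close> have not been looked at yet.
\<close>

definition bfs_inv :: "nat set \<Rightarrow> (nat \<Rightarrow> nat) \<Rightarrow> (nat \<Rightarrow> nat) \<Rightarrow> nat \<Rightarrow> nat \<Rightarrow> nat \<Rightarrow> bool" where
  "bfs_inv X q d t h p \<longleftrightarrow>
     h \<le> t \<and> p \<le> m \<and> (h = 0 \<longrightarrow> p = 0) \<and>
     inj_on q {..<t} \<and> (\<forall>i<t. q i < n) \<and> (\<forall>v<n. d v \<noteq> 0 \<longleftrightarrow> v \<in> q ` {..<t}) \<and>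
     (\<forall>x\<in>X. d x = 1) \<and> (\<forall>i<t. d (q i) \<le> Suc i) \<and>
     (\<forall>i<t. walk_from E X (d (q i) - 1) (q i)) \<and>
     (\<forall>j<t. \<forall>i\<le>j. d (q i) \<le> d (q j)) \<and>
     (\<forall>j<t. d (q j) \<le> (if h = 0 then 1 else Suc (d (q (h - 1))))) \<and>
     (\<forall>e<m. \<forall>i<h. src e = q i \<longrightarrow> (Suc i = h \<longrightarrow> p \<le> e) \<longrightarrow>
        d (tgt e) \<noteq> 0 \<and> d (tgt e) \<le> Suc (d (src e)))"

lemma bfs_inv_t: assumes "bfs_inv X q d t h p" shows "t \<le> n" "h \<le> n"
proof -
  have "inj_on q {..<t}" "q ` {..<t} \<subseteq> {..<n}" using assms by (auto simp: bfs_inv_def)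
  then show "t \<le> n" using card_inj_on_le[of q "{..<t}" "{..<n}"] by simp
  then show "h \<le> n" using assms by (simp add: bfs_inv_def)
qed

text \<open>The bound on queued labels moves on to \<open>q h\<close> because labels increase along
  the queue. The pointer may start at \<open>last_edge\<close>, since later edges do not leave
  \<open>q h\<close>.\<close>

lemma bfs_inv_pop:
  assumes inv: "bfs_inv X q d t h 0" and "h < t"
  shows "bfs_inv X q d t (Suc h) (last_edge src (q h) m)"
proof -
  have "d (q j) \<le> Suc (d (q h))" if "j < t" for j
  proof (cases "h = 0")
    case True
    then show ?thesis using inv that by (auto simp: bfs_inv_def)
  next
    case False
    then have "d (q j) \<le> Suc (d (q (h - 1)))" using inv that by (auto simp: bfs_inv_def)
    moreover have "d (q (h - 1)) \<le> d (q h)" using inv \<open>h < t\<close> by (auto simp: bfs_inv_def)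
    ultimately show ?thesis by simp
  qed
  moreover have "d (tgt e) \<noteq> 0 \<and> d (tgt e) \<le> Suc (d (src e))"
    if "e < m" "i < Suc h" "src e = q i" "Suc i = Suc h \<longrightarrow> last_edge src (q h) m \<le> e" for e i
    using that inv last_edge_none[of src "q h" m e]
    by (cases "i = h") (auto simp: bfs_inv_def less_Suc_eq)
  ultimately show ?thesis
    using assms last_edge_le[of src "q h" m] unfolding bfs_inv_def by simp
qed

text \<open>The target is queued, so its label is at most one above that of the source: edge
  \<open>e\<close> is settled. The edges jumped over leave other vertices.\<close>

lemma bfs_inv_skip:
  assumes inv: "bfs_inv X q d t h (Suc e)" and s: "src e = q (h - 1)" and "d (tgt e) \<noteq> 0"
  shows "bfs_inv X q d t h (last_edge src (q (h - 1)) e)"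
proof -
  have e: "e < m" "h \<noteq> 0" using inv by (auto simp: bfs_inv_def)
  have "tgt e \<in> q ` {..<t}" using inv assms(3) tgt_less[OF e(1)] by (auto simp: bfs_inv_def)
  then have 1: "d (tgt e) \<le> Suc (d (src e))" using inv e s by (auto simp: bfs_inv_def)
  have "d (tgt e') \<noteq> 0 \<and> d (tgt e') \<le> Suc (d (src e'))"
    if a: "e' < m" "i < h" "src e' = q i" "Suc i = h \<longrightarrow> last_edge src (q (h - 1)) e \<le> e'" for e' i
  proof (cases "Suc i = h")
    case False
    then show ?thesis using a inv by (auto simp: bfs_inv_def)
  next
    case True
    then have "\<not> e' < e" using a last_edge_none[of src "q (h - 1)" e e'] by auto
    then consider "e' = e" | "Suc e \<le> e'" by linarith
    then show ?thesis using a inv 1 assms(3) by cases (auto simp: bfs_inv_def)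
  qed
  then show ?thesis using inv e last_edge_le[of src "q (h - 1)" e] unfolding bfs_inv_def by auto
qed

text \<open>Only labels and queue change; the pointer stays at \<open>Suc e\<close>, and
  \<open>bfs_inv_skip\<close> then moves it past \<open>e\<close>, whose target is now
  labelled.\<close>

lemma bfs_inv_visit:
  assumes inv: "bfs_inv X q d t h (Suc e)" and s: "src e = q (h - 1)" and new: "d (tgt e) = 0"
  shows "bfs_inv X (q(t := tgt e)) (d(tgt e := Suc (d (q (h - 1))))) (Suc t) h (Suc e)"
proof -
  let ?v = "tgt e" and ?u = "q (h - 1)"
  let ?q = "q(t := ?v)" and ?d = "d(?v := Suc (d ?u))"
  have e: "e < m" "h \<noteq> 0" and vn: "?v < n" using inv tgt_less by (auto simp: bfs_inv_def)
  have ht: "h \<le> t" using inv by (simp add: bfs_inv_def)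
  have nv: "q i \<noteq> ?v" if "i < t" for i using inv new that vn by (auto simp: bfs_inv_def)
  have ut: "h - 1 < t" using e ht by simp
  have dv: "d v \<noteq> 0 \<Longrightarrow> ?d v = d v" for v using new by auto
  have X: "d x = 1" if "x \<in> X" for x using inv that by (auto simp: bfs_inv_def)
  have top: "d (q j) \<le> Suc (d ?u)" if "j < t" for j using inv e that by (auto simp: bfs_inv_def)
  have mono: "d (q i) \<le> d (q j)" if "i \<le> j" "j < t" for i j using inv that by (auto simp: bfs_inv_def)
  have pos: "d (q i) \<noteq> 0" if "i < t" for i using inv that by (auto simp: bfs_inv_def)
  have "walk_from E X (d ?u - 1) ?u" using inv ut by (auto simp: bfs_inv_def)
  moreover have "(?u, ?v) \<in> E" using e s unfolding edges_of_def by (metis (mono_tags, lifting) mem_Collect_eq)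
  ultimately have walk: "walk_from E X (d ?u) ?v"
    using pos[OF ut] relpow_Suc_I[of _ ?u "d ?u - 1" E ?v] unfolding walk_from_def by auto
  have "inj_on ?q {..<Suc t}"
  proof -
    have "inj_on q {..<t}" using inv by (simp add: bfs_inv_def)
    moreover have "\<forall>i<t. q i \<noteq> ?v" using nv by blast
    ultimately show ?thesis by (auto simp: inj_on_def less_Suc_eq)
  qed
  moreover have "\<forall>i<Suc t. ?q i < n" using inv vn by (auto simp: bfs_inv_def less_Suc_eq)
  moreover have "\<forall>v<n. ?d v \<noteq> 0 \<longleftrightarrow> v \<in> ?q ` {..<Suc t}"
  proof -
    have "?q ` {..<Suc t} = insert ?v (q ` {..<t})" by (auto simp: lessThan_Suc)
    then show ?thesis using inv by (auto simp: bfs_inv_def)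
  qed
  moreover have "\<forall>x\<in>X. ?d x = 1" using X new by auto
  \<comment> \<open>This clause keeps labels within \<open>n\<close>, which excludes overflow when
    they are incremented.\<close>
  moreover have "\<forall>i<Suc t. ?d (?q i) \<le> Suc i"
  proof -
    have "d ?u \<le> Suc (h - 1)" using inv ut unfolding bfs_inv_def by blast
    then have "Suc (d ?u) \<le> Suc t" using e ht by simp
    moreover have "d (q i) \<le> Suc i" if "i < t" for i using inv that by (auto simp: bfs_inv_def)
    ultimately show ?thesis using nv by (simp add: less_Suc_eq)
  qed
  moreover have "\<forall>i<Suc t. walk_from E X (?d (?q i) - 1) (?q i)"
  proof -
    have "walk_from E X (d (q i) - 1) (q i)" if "i < t" for i using inv that by (auto simp: bfs_inv_def)
    then show ?thesis using nv walk by (simp add: less_Suc_eq)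
  qed
  \<comment> \<open>The queue stays sorted because no queued label exceeds
    \<open>Suc (d ?u)\<close>, the label just appended.\<close>
  moreover have "\<forall>j<Suc t. \<forall>i\<le>j. ?d (?q i) \<le> ?d (?q j)"
    using nv mono top by (simp add: less_Suc_eq le_less)
  moreover have "\<forall>j<Suc t. ?d (?q j) \<le> (if h = 0 then 1 else Suc (?d (?q (h - 1))))"
    using top e nv[OF ut] nv ut by (auto simp: less_Suc_eq)
  moreover have "?d (tgt e') \<noteq> 0 \<and> ?d (tgt e') \<le> Suc (?d (src e'))"
    if "e' < m" "i < h" "src e' = ?q i" "Suc i = h \<longrightarrow> Suc e \<le> e'" for e' i
  proof -
    have it: "i < t" using that ht by simp
    then have "src e' = q i" using that by simp
    then have "d (tgt e') \<noteq> 0" "d (tgt e') \<le> Suc (d (src e'))"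
      using inv that unfolding bfs_inv_def by blast+
    then show ?thesis using dv nv[OF it] \<open>src e' = q i\<close> by simp
  qed
  ultimately show ?thesis using inv ht unfolding bfs_inv_def by auto
qed

text \<open>A nonzero label comes with a walk. Conversely, once the queue is exhausted, all edges
  from labelled vertices are settled, so by induction along any walk labels grow by at most one per
  edge.\<close>

lemma bfs_inv_final:
  assumes inv: "bfs_inv X q d t t 0" and X: "X \<subseteq> {..<n}" and v: "v < n"
  shows "d v = sdist E X v"
proof -
  have reach: "v < n \<and> d v \<noteq> 0 \<and> d v \<le> Suc k" if "walk_from E X k v" for k v
    using that
  proof (induction k arbitrary: v)
    case 0
    then show ?case using inv X by (auto simp: walk_from_def bfs_inv_def)
  next
    case (Suc k)
    then obtain u where u: "walk_from E X k u" "(u, v) \<in> E" by (auto simp: walk_from_def)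
    then obtain e where e: "e < m" "u = src e" "v = tgt e" by (auto simp: edges_of_def)
    have IH: "d u \<noteq> 0" "d u \<le> Suc k" "u < n" using Suc.IH u by auto
    then obtain i where "i < t" "u = q i" using inv by (auto simp: bfs_inv_def)
    moreover have "\<forall>e<m. \<forall>i<t. src e = q i \<longrightarrow> (Suc i = t \<longrightarrow> 0 \<le> e) \<longrightarrow>
        d (tgt e) \<noteq> 0 \<and> d (tgt e) \<le> Suc (d (src e))"
      using inv unfolding bfs_inv_def by fast
    ultimately have "d v \<noteq> 0 \<and> d v \<le> Suc (d u)" using e by simp
    then show ?case using IH e tgt_less by auto
  qed
  show ?thesis
  proof (rule sdist_eqI[symmetric])
    assume "d v \<noteq> 0"
    then show "walk_from E X (d v - 1) v" using inv v by (auto simp: bfs_inv_def)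
  qed (use reach in blast)
qed

lemma bfs_inv_init:
  assumes "q ` {..<t} = X" "inj_on q {..<t}" "X \<subseteq> {..<n}" "\<forall>v<n. d v = (if v \<in> X then 1 else 0)"
  shows "bfs_inv X q d t 0 0"
proof -
  have "q i \<in> X" if "i < t" for i using assms that by auto
  moreover have "d x = 1" if "x \<in> X" for x using assms that by auto
  ultimately show ?thesis using assms unfolding bfs_inv_def
    by (auto simp: walk_from_def)
qed

end

section \<open>The algorithm\<close>

text \<open>
  Array 0 is the input. Array 2 maps a vertex to its last outgoing edge, array 3 an edge to the
  preceding one with the same source. Array 4 lists the boundary vertices, which are marked in
  array 7, array 5 is the queue, and array 6 holds distances plus one.

  Registers 2 to 6 hold 0, 1, the number of vertices, the number of edges, and the offset of
  the characteristic vector in the input. Register 16 is the length of array 4; a search starts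
  from its entries between registers 17 and 18, the queue lies between registers 20 and 19, and
  the largest distance plus one is returned in register 22. Register 23 accumulates the maximum
  over the single-source searches, register 25 saves the result of the forward search from the
  whole boundary, and register 30 is set as soon as some vertex is not reached.

  With \<open>bw\<close> set, the edges are traversed backwards and \<open>S\<close> and \<open>T\<close> swap their roles.
\<close>

definition skip :: cmd where "skip = CConst 98 0"

definition clear_body :: cmd where
  "clear_body = CStore 2 8 2 ;; CStore 7 8 2 ;; CStore 6 8 2 ;; CAdd 8 8 3"

definition clear :: cmd where
  "clear = CConst 8 0 ;; CWhile 8 4 clear_body"

text \<open>Registers 12 and 13 hold the input addresses of source and target and advance by two,
  which replaces a multiplication. One strict comparison of the two characteristic bits detects an
  edge leaving the starting side; array 7 keeps its source from being listed twice.\<close>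

definition build_body :: "bool \<Rightarrow> cmd" where
  "build_body bw =
     CLoad 9 0 12 ;; CLoad 10 0 13 ;;
     CLoad 11 2 9 ;; CStore 3 8 11 ;; CAdd 8 8 3 ;; CStore 2 9 8 ;;
     CAdd 14 6 9 ;; CLoad 14 0 14 ;; CAdd 15 6 10 ;; CLoad 15 0 15 ;;
     CIf (if bw then 14 else 15) (if bw then 15 else 14)
       (CLoad 11 7 9 ;; CIf 11 3 (CStore 7 9 3 ;; CStore 4 16 9 ;; CAdd 16 16 3) skip)
       skip ;;
     CAdd 12 12 3 ;; CAdd 12 12 3 ;; CAdd 13 13 3 ;; CAdd 13 13 3"

definition build :: "bool \<Rightarrow> cmd" where
  "build bw = CConst 8 0 ;; CConst 16 0 ;;
     CConst 12 (2 + of_bool bw) ;; CConst 13 (3 - of_bool bw) ;; CWhile 8 5 (build_body bw)"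

definition seed_body :: cmd where
  "seed_body = CLoad 11 4 17 ;; CStore 6 11 3 ;; CStore 5 19 11 ;; CAdd 19 19 3 ;; CAdd 17 17 3"

definition seed :: cmd where
  "seed = CConst 19 0 ;; CWhile 17 18 seed_body"

text \<open>Register 8 is the edge number plus one, so doubling it and adding
  \<open>1 - of_bool bw\<close> yields the input address \<open>3 - of_bool bw + 2 * e\<close> of
  the target. The final load moves to the preceding edge of the same source.\<close>

definition relax :: "bool \<Rightarrow> cmd" where
  "relax bw =
     CAdd 11 8 8 ;; CConst 10 (1 - of_bool bw) ;; CAdd 11 11 10 ;; CLoad 10 0 11 ;; CLoad 11 6 10 ;;
     CIf 11 3 (CStore 6 10 21 ;; CStore 5 19 10 ;; CAdd 19 19 3) skip ;;
     CSub 8 8 3 ;; CLoad 8 3 8"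

definition pop :: cmd where
  "pop = CLoad 9 5 20 ;; CAdd 20 20 3 ;; CLoad 21 6 9 ;; CAdd 21 21 3 ;; CLoad 8 2 9"

definition search :: "bool \<Rightarrow> cmd" where
  "search bw = CConst 20 0 ;; CWhile 20 19 (pop ;; CWhile 2 8 (relax bw))"

text \<open>Zeroing array 6 on the way lets the next search start clean. The outer test selects, by
  their bits, the vertices of the opposite side; a value 0 there means unreached.\<close>

definition scan_body :: "bool \<Rightarrow> cmd" where
  "scan_body bw =
     CLoad 11 6 8 ;; CStore 6 8 2 ;; CAdd 10 6 8 ;; CLoad 10 0 10 ;;
     CIf (if bw then 2 else 10) (if bw then 10 else 3)
       (CIf 11 3 (CConst 30 1) (CIf 22 11 (CAdd 22 11 2) skip))
       skip ;;
     CAdd 8 8 3"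

definition scan :: "bool \<Rightarrow> cmd" where
  "scan bw = CConst 8 0 ;; CConst 22 0 ;; CWhile 8 4 (scan_body bw)"

definition bfs :: "bool \<Rightarrow> cmd" where
  "bfs bw = seed ;; search bw ;; scan bw"

definition start :: cmd where
  "start = CAdd 17 24 2 ;; CAdd 24 24 3 ;; CAdd 18 24 2"

definition keep_max :: cmd where
  "keep_max = CIf 23 22 (CAdd 23 22 2) skip"

text \<open>The same \<open>bfs\<close> runs on one-entry slices of array 4 and finally on all of
  it. Registers 23 and 30 are not reset, so the second half continues the maximum and the flag of
  the first.\<close>

definition half :: "bool \<Rightarrow> cmd" where
  "half bw = clear ;; build bw ;; CConst 24 0 ;; CWhile 24 16 (start ;; bfs bw ;; keep_max) ;;
     CConst 17 0 ;; CAdd 18 16 2 ;; bfs bw"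

text \<open>\<open>Max\<close> is unspecified on the empty set, which arises when no edge crosses;
  the default 0 is harmless for distances plus one.\<close>

definition is_max0 :: "nat \<Rightarrow> nat set \<Rightarrow> bool" where
  "is_max0 m A \<longleftrightarrow> (\<forall>a\<in>A. a \<le> m) \<and> (m = 0 \<or> m \<in> A)"

lemma is_max0_le: "is_max0 m A \<Longrightarrow> a \<in> A \<Longrightarrow> a \<le> m"
  by (simp add: is_max0_def)

lemma is_max0_insert: "is_max0 m A \<Longrightarrow> is_max0 (if m < a then a else m) (insert a A)"
  by (auto simp: is_max0_def)

lemma is_max0_Un: "is_max0 m A \<Longrightarrow> is_max0 l B \<Longrightarrow> is_max0 (if m < l then l else m) (A \<union> B)"
  by (auto simp: is_max0_def)

section \<open>Preserved state; correctness and cost of the searches in one direction\<close>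

definition keeps :: "nat set \<Rightarrow> nat set \<Rightarrow> array_state \<Rightarrow> array_state \<Rightarrow> bool" where
  "keeps rs js s s' \<longleftrightarrow> (\<forall>r\<in>rs. fst s' r = fst s r) \<and> (\<forall>j\<in>js. snd s' j = snd s j)"

lemma keeps_refl [simp]: "keeps rs js s s"
  by (simp add: keeps_def)

lemma keeps_trans: "keeps rs js s s' \<Longrightarrow> keeps rs' js' s' s'' \<Longrightarrow> rs'' \<subseteq> rs \<inter> rs' \<Longrightarrow>
    js'' \<subseteq> js \<inter> js' \<Longrightarrow> keeps rs'' js'' s s''"
  unfolding keeps_def by (metis IntE subsetD)

definition frame :: "nat \<Rightarrow> nat \<Rightarrow> (nat \<Rightarrow> nat) \<Rightarrow> array_state \<Rightarrow> bool" where
  "frame n m I s \<longleftrightarrow>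
     fst s 2 = 0 \<and> fst s 3 = 1 \<and> fst s 4 = n \<and> fst s 5 = m \<and> fst s 6 = 2 + 2 * m \<and> snd s 0 = I"

text \<open>\<open>S\<close> is the side where the searches of this direction start. The stored bits
  describe the forward starting side, so when \<open>bw\<close> holds the vertices of
  \<open>S\<close> carry bit 0. The \<open>of_bool bw\<close> offsets read each edge
  backwards.\<close>

locale directed_half = array_machine N w + bfs_graph n m src tgt
  for N w n m :: nat and src tgt :: "nat \<Rightarrow> nat" +
  fixes bw :: bool and S :: "nat set" and I :: "nat \<Rightarrow> nat"
  assumes N_eq: "N = 2 + 2 * m + n"
    and I_src: "e < m \<Longrightarrow> I (2 + of_bool bw + 2 * e) = src e"
    and I_tgt: "e < m \<Longrightarrow> I (3 - of_bool bw + 2 * e) = tgt e"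
    and I_S: "v < n \<Longrightarrow> I (2 + 2 * m + v) = (if (v \<in> S) = bw then 0 else 1)"
begin

text \<open>At \<open>k = m\<close> this is S' in the forward instance and T' in the backward one;
  the parameter follows the edges already read by \<open>build\<close>.\<close>

definition cut :: "nat \<Rightarrow> nat set" where
  "cut k = {src e | e. e < k \<and> src e \<in> S \<and> tgt e \<notin> S}"

lemma cut_0 [simp]: "cut 0 = {}"
  by (simp add: cut_def)

lemma cut_Suc: "cut (Suc e) = (if src e \<in> S \<and> tgt e \<notin> S then insert (src e) (cut e) else cut e)"
  by (auto simp: cut_def less_Suc_eq)

lemma cut_eq: "cut m = {u \<in> S. \<exists>v. (u, v) \<in> E \<and> v \<notin> S}"
  by (auto simp: cut_def edges_of_def)

lemma cut_subset: "cut m \<subseteq> {..<n}"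
  by (auto simp: cut_def src_less)

lemma word_bound: "16 + 16 * m + 8 * n \<le> 2 ^ w"
  using no_overflow by (simp add: N_eq)

lemma clear_ok:
  assumes "frame n m I s0"
  shows "ok clear (8 * n + 2) s0 (\<lambda>s. keeps {2, 3, 4, 5, 6, 23, 25, 30} {0} s0 s \<and>
    (\<forall>v<n. snd s 2 v = 0 \<and> snd s 7 v = 0 \<and> snd s 6 v = 0))"
proof -
  let ?I = "\<lambda>s. keeps {2, 3, 4, 5, 6, 23, 25, 30} {0} s0 s \<and> fst s 8 \<le> n \<and>
    (\<forall>v<fst s 8. snd s 2 v = 0 \<and> snd s 7 v = 0 \<and> snd s 6 v = 0)"
  let ?\<Phi> = "\<lambda>s. 8 * (n - fst s 8)"
  have loop: "ok (CWhile 8 4 clear_body) (?\<Phi> s + 1) s (\<lambda>s'. ?I s' \<and> \<not> fst s' 8 < fst s' 4)" if "?I s" for s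
  proof (rule ok_while_wp[where I = ?I and \<Phi> = ?\<Phi>])
    fix s assume I: "?I s" and "fst s 8 < fst s 4"
    then show "wp N w clear_body (\<lambda>s'. ?I s' \<and> cost clear_body + 1 + ?\<Phi> s' \<le> ?\<Phi> s) s"
      using assms word_bound
      by (auto simp: clear_body_def frame_def keeps_def N_eq less_Suc_eq)
  qed (use that in simp_all)
  have "ok clear (1 + (8 * n + 1)) s0 (\<lambda>s'. ?I s' \<and> \<not> fst s' 8 < fst s' 4)"
    unfolding clear_def using loop[of "((fst s0)(8 := 0), snd s0)"] word_bound
    by (intro ok_const_seq) (simp_all add: keeps_def)
  then show ?thesis
    by (rule ok_mono) (use assms in \<open>auto simp: keeps_def frame_def\<close>)
qed

definition adjacency :: "nat \<Rightarrow> array_state \<Rightarrow> bool" where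
  "adjacency e s \<longleftrightarrow>
     (\<forall>u<n. snd s 2 u = last_edge src u e) \<and> (\<forall>e'<e. snd s 3 e' = last_edge src (src e') e') \<and>
     inj_on (snd s 4) {..<fst s 16} \<and> snd s 4 ` {..<fst s 16} = cut e"

lemma adjacency_count:
  assumes "adjacency e s" and "e \<le> m"
  shows "fst s 16 = card (cut e)" and "fst s 16 \<le> n"
proof -
  show "fst s 16 = card (cut e)"
    using assms card_image[of "snd s 4" "{..<fst s 16}"] by (simp add: adjacency_def)
  moreover have "cut e \<subseteq> {..<n}" using assms(2) src_less by (auto simp: cut_def)
  ultimately show "fst s 16 \<le> n"
    using card_mono[of "{..<n}" "cut e"] by simp
qed

lemma build_step:
  assumes fr: "frame n m I s" and e: "fst s 8 < m"
    and pos: "fst s 12 = 2 + of_bool bw + 2 * fst s 8" "fst s 13 = 3 - of_bool bw + 2 * fst s 8"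
    and adj: "adjacency (fst s 8) s"
    and mark: "\<forall>u<n. snd s 7 u = of_bool (u \<in> cut (fst s 8))"
  shows "wp N w (build_body bw) (\<lambda>s'. keeps {2, 3, 4, 5, 6, 23, 25, 30} {0, 6} s s' \<and>
    fst s' 8 = Suc (fst s 8) \<and>
    fst s' 12 = 2 + of_bool bw + 2 * fst s' 8 \<and> fst s' 13 = 3 - of_bool bw + 2 * fst s' 8 \<and>
    adjacency (fst s' 8) s' \<and> (\<forall>u<n. snd s' 7 u = of_bool (u \<in> cut (fst s' 8)))) s"
proof -
  let ?e = "fst s 8" and ?k = "fst s 16"
  let ?u = "src ?e" and ?v = "tgt ?e"
  have un: "?u < n" and vn: "?v < n" using e src_less tgt_less by auto
  have Iu: "I (fst s 12) = ?u" and Iv: "I (fst s 13) = ?v"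
    using e I_src I_tgt pos by auto
  have kn: "?k \<le> n" using adjacency_count(2)[OF adj] e by simp
  have addr: "fst s 12 < N" "fst s 13 < N" "2 + 2 * m + ?u < N" "2 + 2 * m + ?v < N" "?e < N" "?u < N" "?k < N"
    using e pos un vn kn by (auto simp: N_eq split: if_splits)
  have b: "2 + 2 * m + ?u < 2 ^ w" "2 + 2 * m + ?v < 2 ^ w" "Suc ?e < 2 ^ w" "Suc ?k < 2 ^ w"
      "Suc (Suc (fst s 12)) < 2 ^ w" "Suc (Suc (fst s 13)) < 2 ^ w"
      "(Suc (fst s 12)) < 2 ^ w" "(Suc (fst s 13)) < 2 ^ w"
    using word_bound e pos un vn kn by (auto split: if_splits)
  have m1: "snd s 7 ?u = of_bool (?u \<in> cut ?e)" using mark un by blast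
  have a2: "snd s 2 ?u = last_edge src ?u ?e" using adj un by (simp add: adjacency_def)
  have L: "inj_on ((snd s 4)(?k := ?u)) {..<Suc ?k}" "((snd s 4)(?k := ?u)) ` {..<Suc ?k} = insert ?u (cut ?e)"
    if "?u \<notin> cut ?e"
  proof -
    have "inj_on (snd s 4) {..<?k}" and im: "snd s 4 ` {..<?k} = cut ?e"
      using adj by (auto simp: adjacency_def)
    moreover have "snd s 4 i \<in> cut ?e" if "i < ?k" for i
      unfolding im[symmetric] using that by simp
    then have "\<forall>i<?k. snd s 4 i \<noteq> ?u" using that by metis
    ultimately show "inj_on ((snd s 4)(?k := ?u)) {..<Suc ?k}"
      using \<open>\<forall>i<?k. snd s 4 i \<noteq> ?u\<close>
      by (auto simp: inj_on_def less_Suc_eq)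
    show "((snd s 4)(?k := ?u)) ` {..<Suc ?k} = insert ?u (cut ?e)"
      using im by (auto simp: lessThan_Suc)
  qed
  have adj': "\<forall>u<n. ((snd s 2)(?u := Suc ?e)) u = last_edge src u (Suc ?e)"
      "\<forall>e'<Suc ?e. ((snd s 3)(?e := last_edge src ?u ?e)) e' = last_edge src (src e') e'"
    using adj by (auto simp: adjacency_def less_Suc_eq)
  have S: "(if bw then I (2 + 2 * m + ?u) < I (2 + 2 * m + ?v) else I (2 + 2 * m + ?v) < I (2 + 2 * m + ?u))
      \<longleftrightarrow> ?u \<in> S \<and> ?v \<notin> S"
    using I_S[OF un] I_S[OF vn] by auto
  have fr': "fst s 2 = 0" "fst s 3 = 1" "fst s 4 = n" "fst s 5 = m" "fst s 6 = 2 + 2 * m" "snd s 0 = I"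
    using fr by (simp_all add: frame_def)
  let ?c = "?u \<in> S \<and> ?v \<notin> S \<and> ?u \<notin> cut ?e"
  \<comment> \<open>Symbolic execution yields plain array updates; \<open>wp_mono\<close> turns them
    into the invariant afterwards, so that the simplifier does not carry the invariant through every
    instruction.\<close>
  have "wp N w (build_body bw) (\<lambda>s'. keeps {2, 3, 4, 5, 6, 23, 25, 30} {0, 6} s s' \<and>
    fst s' 8 = Suc ?e \<and> fst s' 12 = fst s 12 + 2 \<and> fst s' 13 = fst s 13 + 2 \<and>
    snd s' 2 = (snd s 2)(?u := Suc ?e) \<and> snd s' 3 = (snd s 3)(?e := last_edge src ?u ?e) \<and>
    fst s' 16 = (if ?c then Suc ?k else ?k) \<and>
    snd s' 4 = (if ?c then (snd s 4)(?k := ?u) else snd s 4) \<and>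
    snd s' 7 = (if ?c then (snd s 7)(?u := 1) else snd s 7)) s"
  proof (cases bw)
    case True
    show ?thesis
      unfolding build_body_def skip_def
      using S m1 True b addr by (simp add: fr' Iu Iv a2 keeps_def cong: wp_cong)
  next
    case False
    show ?thesis
      unfolding build_body_def skip_def
      using S m1 False b addr by (simp add: fr' Iu Iv a2 keeps_def cong: wp_cong)
  qed
  then show ?thesis
  proof (rule wp_mono)
    fix s' assume s': "keeps {2, 3, 4, 5, 6, 23, 25, 30} {0, 6} s s' \<and>
      fst s' 8 = Suc ?e \<and> fst s' 12 = fst s 12 + 2 \<and> fst s' 13 = fst s 13 + 2 \<and>
      snd s' 2 = (snd s 2)(?u := Suc ?e) \<and> snd s' 3 = (snd s 3)(?e := last_edge src ?u ?e) \<and>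
      fst s' 16 = (if ?c then Suc ?k else ?k) \<and>
      snd s' 4 = (if ?c then (snd s 4)(?k := ?u) else snd s 4) \<and>
      snd s' 7 = (if ?c then (snd s 7)(?u := 1) else snd s 7)"
    have "adjacency (Suc ?e) s'"
      unfolding adjacency_def
      using s' adj' L adj by (auto simp: adjacency_def cut_Suc insert_absorb simp del: fun_upd_apply last_edge.simps)
    moreover have "\<forall>u<n. snd s' 7 u = of_bool (u \<in> cut (Suc ?e))"
      using s' mark by (auto simp: cut_Suc insert_absorb)
    ultimately show "keeps {2, 3, 4, 5, 6, 23, 25, 30} {0, 6} s s' \<and> fst s' 8 = Suc ?e \<and>
      fst s' 12 = 2 + of_bool bw + 2 * fst s' 8 \<and> fst s' 13 = 3 - of_bool bw + 2 * fst s' 8 \<and>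
      adjacency (fst s' 8) s' \<and> (\<forall>u<n. snd s' 7 u = of_bool (u \<in> cut (fst s' 8)))"
      using s' pos by (cases bw) simp_all
  qed
qed

lemma build_ok:
  assumes fr: "frame n m I s0" and zero: "\<forall>v<n. snd s0 2 v = 0 \<and> snd s0 7 v = 0"
  shows "ok (build bw) (32 * m + 5) s0 (\<lambda>s. keeps {2, 3, 4, 5, 6, 23, 25, 30} {0, 6} s0 s \<and> adjacency m s)"
proof -
  let ?I = "\<lambda>s. keeps {2, 3, 4, 5, 6, 23, 25, 30} {0, 6} s0 s \<and> fst s 8 \<le> m \<and>
    fst s 12 = 2 + of_bool bw + 2 * fst s 8 \<and> fst s 13 = 3 - of_bool bw + 2 * fst s 8 \<and>
    adjacency (fst s 8) s \<and> (\<forall>u<n. snd s 7 u = of_bool (u \<in> cut (fst s 8)))"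
  let ?\<Phi> = "\<lambda>s. 32 * (m - fst s 8)"
  let ?s = "((fst s0)(8 := 0, 16 := 0, 12 := 2 + of_bool bw, 13 := 3 - of_bool bw), snd s0)"
  have cost: "cost (build_body bw) \<le> 31" by (simp add: build_body_def skip_def)
  have loop: "ok (CWhile 8 5 (build_body bw)) (?\<Phi> s + 1) s (\<lambda>s'. ?I s' \<and> \<not> fst s' 8 < fst s' 5)" if "?I s" for s
  proof (rule ok_while_wp[where I = ?I and \<Phi> = ?\<Phi>])
    fix s assume I: "?I s" and lt: "fst s 8 < fst s 5"
    have fr_s: "frame n m I s" using fr I by (auto simp: frame_def keeps_def)
    then have e: "fst s 8 < m" using lt by (simp add: frame_def)
    then show "wp N w (build_body bw) (\<lambda>s'. ?I s' \<and> cost (build_body bw) + 1 + ?\<Phi> s' \<le> ?\<Phi> s) s"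
      using I cost by (intro wp_mono[OF build_step[OF fr_s]]) (auto intro: keeps_trans)
  qed (use that in simp_all)
  have "?I ?s" using zero by (simp add: keeps_def adjacency_def)
  then have "ok (build bw) (1 + (1 + (1 + (1 + (?\<Phi> ?s + 1))))) s0 (\<lambda>s'. ?I s' \<and> \<not> fst s' 8 < fst s' 5)"
    unfolding build_def using loop[of ?s] word_bound by (intro ok_const_seq) simp_all
  then show ?thesis
    by (rule ok_mono) (use fr in \<open>auto simp: keeps_def frame_def\<close>)
qed

lemma seed_ok:
  assumes fr: "frame n m I s0" and adj: "adjacency m s0"
    and lo: "fst s0 17 \<le> fst s0 18" "fst s0 18 \<le> fst s0 16"
    and zero: "\<forall>v<n. snd s0 6 v = 0"
  shows "ok seed (10 * n + 2) s0 (\<lambda>s. keeps {2, 3, 4, 5, 6, 16, 23, 24, 25, 30} {0, 2, 3, 4} s0 s \<and>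
    bfs_inv (snd s0 4 ` {fst s0 17..<fst s0 18}) (snd s 5) (snd s 6) (fst s 19) 0 0)"
proof -
  let ?lo = "fst s0 17" and ?hi = "fst s0 18" and ?L = "snd s0 4"
  let ?I = "\<lambda>s. keeps {2, 3, 4, 5, 6, 16, 18, 23, 24, 25, 30} {0, 2, 3, 4} s0 s \<and>
    ?lo \<le> fst s 17 \<and> fst s 17 \<le> ?hi \<and> fst s 19 = fst s 17 - ?lo \<and>
    (\<forall>i<fst s 19. snd s 5 i = ?L (?lo + i)) \<and> (\<forall>v<n. snd s 6 v = of_bool (v \<in> ?L ` {?lo..<fst s 17}))"
  let ?\<Phi> = "\<lambda>s. 10 * (?hi - fst s 17)"
  let ?s = "((fst s0)(19 := 0), snd s0)"
  have hi: "?hi \<le> n" using adjacency_count(2)[OF adj] lo by simp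
  have inj: "inj_on ?L {..<fst s0 16}" and im: "?L ` {..<fst s0 16} = cut m"
    using adj by (auto simp: adjacency_def)
  have Ln: "?L i < n" if "i < ?hi" for i
  proof -
    have "?L i \<in> cut m" unfolding im[symmetric] using that lo by simp
    then show ?thesis using cut_subset by auto
  qed
  have loop: "ok (CWhile 17 18 seed_body) (?\<Phi> s + 1) s (\<lambda>s'. ?I s' \<and> \<not> fst s' 17 < fst s' 18)" if "?I s" for s
  proof (rule ok_while_wp[where I = ?I and \<Phi> = ?\<Phi>])
    fix s assume I: "?I s" and lt: "fst s 17 < fst s 18"
    have fr': "fst s 2 = 0" "fst s 3 = 1" "fst s 4 = n" "fst s 5 = m" "fst s 18 = ?hi" "snd s 4 = ?L"
      using fr I by (auto simp: frame_def keeps_def)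
    let ?i = "fst s 17"
    have i: "?i < ?hi" using lt fr' by simp
    have b: "?i < N" "?L ?i < N" "fst s 19 < N" "Suc ?i < 2 ^ w" "Suc (fst s 19) < 2 ^ w"
      using i hi Ln[OF i] I word_bound by (auto simp: N_eq)
    have ins: "{?lo..<Suc ?i} = insert ?i {?lo..<?i}" using I by auto
    have "wp N w seed_body (\<lambda>s'. keeps {2, 3, 4, 5, 6, 16, 18, 23, 24, 25, 30} {0, 2, 3, 4} s s' \<and>
      fst s' 17 = Suc ?i \<and> fst s' 19 = Suc (fst s 19) \<and> snd s' 5 = (snd s 5)(fst s 19 := ?L ?i) \<and>
      snd s' 6 = (snd s 6)(?L ?i := 1)) s"
      unfolding seed_body_def using b by (simp add: fr' keeps_def cong: wp_cong)
    then show "wp N w seed_body (\<lambda>s'. ?I s' \<and> cost seed_body + 1 + ?\<Phi> s' \<le> ?\<Phi> s) s"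
    proof (rule wp_mono, intro conjI)
      fix s' assume s': "keeps {2, 3, 4, 5, 6, 16, 18, 23, 24, 25, 30} {0, 2, 3, 4} s s' \<and>
        fst s' 17 = Suc ?i \<and> fst s' 19 = Suc (fst s 19) \<and> snd s' 5 = (snd s 5)(fst s 19 := ?L ?i) \<and>
        snd s' 6 = (snd s 6)(?L ?i := 1)"
      show "keeps {2, 3, 4, 5, 6, 16, 18, 23, 24, 25, 30} {0, 2, 3, 4} s0 s'"
        using s' I by (auto intro: keeps_trans)
      show "\<forall>v<n. snd s' 6 v = of_bool (v \<in> ?L ` {?lo..<fst s' 17})"
        using s' I by (auto simp: ins)
    qed (use I i in \<open>auto simp: seed_body_def less_Suc_eq\<close>)
  qed (use that in simp_all)
  have "?I ?s" using zero lo by (simp add: keeps_def)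
  then have "ok seed (1 + (?\<Phi> ?s + 1)) s0 (\<lambda>s'. ?I s' \<and> \<not> fst s' 17 < fst s' 18)"
    unfolding seed_def using loop[of ?s] word_bound by (intro ok_const_seq) simp_all
  then show ?thesis
  proof (rule ok_mono)
    fix s assume "?I s \<and> \<not> fst s 17 < fst s 18"
    then have I: "?I s" and e: "fst s 17 = ?hi" by (auto simp: keeps_def)
    have im5: "snd s 5 ` {..<fst s 19} = ?L ` {?lo..<?hi}"
    proof -
      have "snd s 5 ` {..<fst s 19} = (\<lambda>i. ?L (?lo + i)) ` {..<?hi - ?lo}" using I e by simp
      also have "\<dots> = ?L ` ((+) ?lo ` {..<?hi - ?lo})" by (simp add: image_image)
      also have "(+) ?lo ` {..<?hi - ?lo} = {?lo..<?hi}" using lo by (simp add: lessThan_atLeast0)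
      finally show ?thesis .
    qed
    moreover have "inj_on (snd s 5) {..<fst s 19}"
    proof (rule inj_onI)
      fix i j assume ij: "i \<in> {..<fst s 19}" "j \<in> {..<fst s 19}" and "snd s 5 i = snd s 5 j"
      then have "?L (?lo + i) = ?L (?lo + j)" using I by simp
      moreover have "?lo + i < fst s0 16" "?lo + j < fst s0 16" using ij I e lo by auto
      ultimately show "i = j" using inj by (auto dest: inj_onD)
    qed
    moreover have "?L ` {?lo..<?hi} \<subseteq> {..<n}" using Ln by auto
    ultimately have "bfs_inv (?L ` {?lo..<?hi}) (snd s 5) (snd s 6) (fst s 19) 0 0"
      using I e by (intro bfs_inv_init) auto
    then show "keeps {2, 3, 4, 5, 6, 16, 23, 24, 25, 30} {0, 2, 3, 4} s0 s \<and>
        bfs_inv (?L ` {?lo..<?hi}) (snd s 5) (snd s 6) (fst s 19) 0 0"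
      using I by (auto simp: keeps_def)
  qed (use hi in simp)
qed

lemma relax_step:
  assumes fr: "frame n m I s" and adj: "\<forall>e<m. snd s 3 e = last_edge src (src e) e"
    and inv: "bfs_inv X (snd s 5) (snd s 6) (fst s 19) h (Suc e)" and p: "fst s 8 = Suc e"
    and u: "src e = snd s 5 (h - 1)" "fst s 21 = Suc (snd s 6 (src e))"
  shows "wp N w (relax bw) (\<lambda>s'. keeps {2, 3, 4, 5, 6, 16, 20, 21, 23, 24, 25, 30} {0, 2, 3, 4} s s' \<and>
    fst s' 8 = last_edge src (src e) e \<and>
    bfs_inv X (snd s' 5) (snd s' 6) (fst s' 19) h (fst s' 8) \<and>
    (\<forall>i<h. snd s' 5 i = snd s 5 i) \<and> snd s' 6 (src e) = snd s 6 (src e)) s"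
proof -
  let ?v = "tgt e" and ?t = "fst s 19" and ?q = "snd s 5" and ?d = "snd s 6"
  let ?du = "Suc (?d (src e))"
  have em: "e < m" and ht: "h \<le> ?t" "h \<noteq> 0" using inv by (auto simp: bfs_inv_def)
  have vn: "?v < n" using em tgt_less by simp
  have un: "src e < n" using em src_less by simp
  have tn: "?t \<le> n" using bfs_inv_t(1)[OF inv] .
  have u0: "?d (src e) \<noteq> 0" using inv u ht by (auto simp: bfs_inv_def)
  have addr: "Suc (Suc (e + e)) + (1 - of_bool bw) = 3 - of_bool bw + 2 * e" by simp
  have Iv: "I (Suc (Suc (e + e)) + (1 - of_bool bw)) = ?v"
    unfolding addr using I_tgt[OF em] .
  have b: "Suc (Suc (e + e)) < 2 ^ w" "Suc (Suc (e + e)) + (1 - of_bool bw) < 2 ^ w" "1 - of_bool bw < (2 :: nat) ^ w"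
      "Suc (Suc (e + e)) + (1 - of_bool bw) < N" "?v < N" "?t < N" "e < N" "Suc ?t < 2 ^ w"
    using em vn tn word_bound by (auto simp: N_eq of_bool_def)
  have fr': "fst s 2 = 0" "fst s 3 = 1" "fst s 4 = n" "fst s 5 = m" "snd s 0 = I"
    using fr by (simp_all add: frame_def)
  have adj': "snd s 3 e = last_edge src (src e) e" using adj em by simp
  have "wp N w (relax bw) (\<lambda>s'. keeps {2, 3, 4, 5, 6, 16, 20, 21, 23, 24, 25, 30} {0, 2, 3, 4} s s' \<and>
    fst s' 8 = last_edge src (src e) e \<and>
    snd s' 5 = (if ?d ?v = 0 then ?q(?t := ?v) else ?q) \<and>
    snd s' 6 = (if ?d ?v = 0 then ?d(?v := ?du) else ?d) \<and>
    fst s' 19 = (if ?d ?v = 0 then Suc ?t else ?t)) s"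
    unfolding relax_def skip_def
    using b Iv by (cases bw) (simp_all add: fr' p u(2) adj' keeps_def cong: wp_cong)
  then show ?thesis
  proof (rule wp_mono)
    fix s' assume s': "keeps {2, 3, 4, 5, 6, 16, 20, 21, 23, 24, 25, 30} {0, 2, 3, 4} s s' \<and>
      fst s' 8 = last_edge src (src e) e \<and>
      snd s' 5 = (if ?d ?v = 0 then ?q(?t := ?v) else ?q) \<and>
      snd s' 6 = (if ?d ?v = 0 then ?d(?v := ?du) else ?d) \<and>
      fst s' 19 = (if ?d ?v = 0 then Suc ?t else ?t)"
    have "bfs_inv X (snd s' 5) (snd s' 6) (fst s' 19) h (last_edge src (src e) e)"
    proof (cases "?d ?v = 0")
      case True
      then have 1: "bfs_inv X (?q(?t := ?v)) (?d(?v := ?du)) (Suc ?t) h (Suc e)"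
        using bfs_inv_visit[OF inv u(1)] u(1) by simp
      have 2: "(?q(?t := ?v)) (h - 1) = src e" using u(1) ht by auto
      show ?thesis using bfs_inv_skip[OF 1, unfolded 2] True s' by simp
    next
      case False
      then show ?thesis using bfs_inv_skip[OF inv u(1)] s' u(1) by simp
    qed
    then show "keeps {2, 3, 4, 5, 6, 16, 20, 21, 23, 24, 25, 30} {0, 2, 3, 4} s s' \<and>
      fst s' 8 = last_edge src (src e) e \<and>
      bfs_inv X (snd s' 5) (snd s' 6) (fst s' 19) h (fst s' 8) \<and>
      (\<forall>i<h. snd s' 5 i = snd s 5 i) \<and> snd s' 6 (src e) = snd s 6 (src e)"
      using s' ht u0 by auto
  qed
qed

text \<open>The potential of the inner loop counts the edges of \<open>u\<close> still ahead;
  jumping over edges of other vertices does not change this count.\<close>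

lemma card_last_edge:
  "card {e. e < last_edge src u p \<and> src e = u} = card {e. e < p \<and> src e = u}"
proof -
  have "{e. e < last_edge src u p \<and> src e = u} = {e. e < p \<and> src e = u}"
    using last_edge_le[of src u p] last_edge_none[of src u p] by (auto simp: not_le[symmetric])
  then show ?thesis by simp
qed

lemma card_edges_Suc:
  assumes "src e = u"
  shows "card {e'. e' < Suc e \<and> src e' = u} = Suc (card {e'. e' < e \<and> src e' = u})"
proof -
  have "{e'. e' < Suc e \<and> src e' = u} = insert e {e'. e' < e \<and> src e' = u}"
    using assms by (auto simp: less_Suc_eq)
  then show ?thesis by simp
qed

lemma relax_ok:
  assumes fr: "frame n m I s0" and adj: "\<forall>e<m. snd s0 3 e = last_edge src (src e) e"
    and inv: "bfs_inv X (snd s0 5) (snd s0 6) (fst s0 19) (Suc h) (fst s0 8)"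
    and h: "fst s0 20 = Suc h"
    and u: "snd s0 5 h = u" "fst s0 21 = Suc (snd s0 6 u)" "fst s0 8 = last_edge src u m"
  shows "ok (CWhile 2 8 (relax bw)) (18 * card {e. e < m \<and> src e = u} + 1) s0
    (\<lambda>s. keeps {2, 3, 4, 5, 6, 16, 20, 23, 24, 25, 30} {0, 2, 3, 4} s0 s \<and>
      bfs_inv X (snd s 5) (snd s 6) (fst s 19) (Suc h) 0 \<and> (\<forall>i<Suc h. snd s 5 i = snd s0 5 i))"
proof -
  let ?I = "\<lambda>s. keeps {2, 3, 4, 5, 6, 16, 20, 21, 23, 24, 25, 30} {0, 2, 3, 4} s0 s \<and>
    bfs_inv X (snd s 5) (snd s 6) (fst s 19) (Suc h) (fst s 8) \<and> (\<forall>i<Suc h. snd s 5 i = snd s0 5 i) \<and>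
    snd s 6 u = snd s0 6 u \<and> (\<exists>p\<le>m. fst s 8 = last_edge src u p)"
  \<comment> \<open>18 is the bound 17 on one pass of \<open>relax\<close> plus the test.\<close>
  let ?\<Phi> = "\<lambda>s. 18 * card {e. e < fst s 8 \<and> src e = u}"
  have loop: "ok (CWhile 2 8 (relax bw)) (?\<Phi> s0 + 1) s0 (\<lambda>s'. ?I s' \<and> \<not> fst s' 2 < fst s' 8)"
  proof (rule ok_while_wp[where I = ?I and \<Phi> = ?\<Phi>])
    fix s assume I: "?I s" and lt: "fst s 2 < fst s 8"
    have fr_s: "frame n m I s" and adj_s: "\<forall>e<m. snd s 3 e = last_edge src (src e) e"
      and u_s: "snd s 5 h = u" "fst s 21 = Suc (snd s 6 u)"
      using fr adj u I by (auto simp: frame_def keeps_def)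
    have "fst s 8 \<noteq> 0" using lt by simp
    then obtain e where e: "fst s 8 = Suc e" by (cases "fst s 8") auto
    then have su: "src e = u" using I last_edge_src[of src u] by metis
    have em: "e < m" using I e by (auto simp: bfs_inv_def)
    have cost: "cost (relax bw) \<le> 17" by (simp add: relax_def skip_def)
    have inv_s: "bfs_inv X (snd s 5) (snd s 6) (fst s 19) (Suc h) (Suc e)" using I e by simp
    have "wp N w (relax bw) (\<lambda>s'. keeps {2, 3, 4, 5, 6, 16, 20, 21, 23, 24, 25, 30} {0, 2, 3, 4} s s' \<and>
      fst s' 8 = last_edge src u e \<and>
      bfs_inv X (snd s' 5) (snd s' 6) (fst s' 19) (Suc h) (fst s' 8) \<and>
      (\<forall>i<Suc h. snd s' 5 i = snd s 5 i) \<and> snd s' 6 u = snd s 6 u) s"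
      using relax_step[OF fr_s adj_s inv_s e] su u_s by simp
    then show "wp N w (relax bw) (\<lambda>s'. ?I s' \<and> cost (relax bw) + 1 + ?\<Phi> s' \<le> ?\<Phi> s) s"
    proof (rule wp_mono)
      fix s' assume s': "keeps {2, 3, 4, 5, 6, 16, 20, 21, 23, 24, 25, 30} {0, 2, 3, 4} s s' \<and>
        fst s' 8 = last_edge src u e \<and>
        bfs_inv X (snd s' 5) (snd s' 6) (fst s' 19) (Suc h) (fst s' 8) \<and>
        (\<forall>i<Suc h. snd s' 5 i = snd s 5 i) \<and> snd s' 6 u = snd s 6 u"
      have "keeps {2, 3, 4, 5, 6, 16, 20, 21, 23, 24, 25, 30} {0, 2, 3, 4} s0 s'"
        using s' I by (auto intro: keeps_trans)
      moreover have "\<exists>p\<le>m. fst s' 8 = last_edge src u p" using s' em by (intro exI[of _ e]) simp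
      moreover have "?\<Phi> s' + 18 = ?\<Phi> s"
        using s' e card_edges_Suc[OF su] by (simp add: card_last_edge)
      moreover have "bfs_inv X (snd s' 5) (snd s' 6) (fst s' 19) (Suc h) (last_edge src u e)" using s' by metis
      ultimately show "?I s' \<and> cost (relax bw) + 1 + ?\<Phi> s' \<le> ?\<Phi> s"
        using s' I cost by simp
    qed
  next
    show "?I s0" using inv u by (auto simp: keeps_def)
  qed simp_all
  have \<Phi>: "?\<Phi> s0 = 18 * card {e. e < m \<and> src e = u}" using u(3) by (simp add: card_last_edge)
  show ?thesis
    by (rule ok_mono[OF loop[unfolded \<Phi>]]) (use fr in \<open>auto simp: keeps_def frame_def\<close>)
qed

lemma search_ok:
  assumes fr: "frame n m I s0" and adj: "adjacency m s0"
    and inv: "bfs_inv X (snd s0 5) (snd s0 6) (fst s0 19) 0 0"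
  shows "ok (search bw) (20 * m + 20 * n + 2) s0
    (\<lambda>s. keeps {2, 3, 4, 5, 6, 16, 23, 24, 25, 30} {0, 2, 3, 4} s0 s \<and>
      bfs_inv X (snd s 5) (snd s 6) (fst s 19) (fst s 19) 0)"
proof -
  let ?I = "\<lambda>s. keeps {2, 3, 4, 5, 6, 16, 23, 24, 25, 30} {0, 2, 3, 4} s0 s \<and>
    bfs_inv X (snd s 5) (snd s 6) (fst s 19) (fst s 20) 0"
  let ?U = "\<lambda>q h. {e. e < m \<and> src e \<notin> q ` {..<h}}"
  \<comment> \<open>Removing a vertex releases 20 for each of its outgoing edges and 20 for itself,
    enough for \<open>pop\<close>, the inner loop and the outer test, together
    \<open>18 * ?deg + 10\<close>.\<close>
  let ?\<Phi> = "\<lambda>s. 20 * card (?U (snd s 5) (fst s 20)) + 20 * (n - fst s 20)"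
  let ?s = "((fst s0)(20 := 0), snd s0)"
  have loop: "ok (CWhile 20 19 (pop ;; CWhile 2 8 (relax bw))) (?\<Phi> ?s + 1) ?s
      (\<lambda>s'. ?I s' \<and> \<not> fst s' 20 < fst s' 19)"
  proof (rule ok_while[where I = ?I and \<Phi> = ?\<Phi>])
    fix s assume I: "?I s" and lt: "fst s 20 < fst s 19"
    let ?h = "fst s 20"
    let ?u = "snd s 5 ?h"
    have inv_s: "bfs_inv X (snd s 5) (snd s 6) (fst s 19) ?h 0" using I by simp
    have un: "?u < n" using inv_s lt by (auto simp: bfs_inv_def)
    have hn: "?h < n" using lt bfs_inv_t[OF inv_s] by simp
    have "snd s 6 ?u \<le> Suc ?h" using inv_s lt by (simp add: bfs_inv_def)
    then have dn: "snd s 6 ?u \<le> n" using hn by simp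
    have fr_s: "frame n m I s" and adj_s: "adjacency m s"
      using fr adj I by (auto simp: frame_def keeps_def adjacency_def)
    have fr': "fst s 2 = 0" "fst s 3 = 1" "fst s 4 = n" "fst s 5 = m" "snd s 0 = I"
      using fr_s by (simp_all add: frame_def)
    have a2: "snd s 2 ?u = last_edge src ?u m" using adj_s un by (simp add: adjacency_def)
    let ?deg = "card {e. e < m \<and> src e = ?u}"
    let ?Q = "\<lambda>s1. keeps {2, 3, 4, 5, 6, 16, 19, 23, 24, 25, 30} {0, 2, 3, 4, 5, 6} s s1 \<and>
      fst s1 20 = Suc ?h \<and> fst s1 21 = Suc (snd s 6 ?u) \<and> fst s1 8 = last_edge src ?u m"
    have "wp N w pop ?Q s"
      unfolding pop_def
      using un hn dn a2 word_bound by (simp add: fr' keeps_def N_eq cong: wp_cong)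
    then have "ok pop 8 s ?Q"
      by (rule ok_mono[OF ok_wp]) (simp_all add: pop_def)
    moreover have "ok (CWhile 2 8 (relax bw)) (18 * ?deg + 1) s1
        (\<lambda>s'. ?I s' \<and> 18 * ?deg + 10 + ?\<Phi> s' \<le> ?\<Phi> s)" if s1: "?Q s1" for s1
    proof -
      have fr1: "frame n m I s1" using fr_s s1 by (auto simp: frame_def keeps_def)
      have arr: "snd s1 5 = snd s 5" "snd s1 6 = snd s 6" "snd s1 3 = snd s 3" "fst s1 19 = fst s 19"
        using s1 by (auto simp: keeps_def)
      have "ok (CWhile 2 8 (relax bw)) (18 * ?deg + 1) s1
        (\<lambda>s. keeps {2, 3, 4, 5, 6, 16, 20, 23, 24, 25, 30} {0, 2, 3, 4} s1 s \<and>
          bfs_inv X (snd s 5) (snd s 6) (fst s 19) (Suc ?h) 0 \<and> (\<forall>i<Suc ?h. snd s 5 i = snd s1 5 i))"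
        using adj_s s1 bfs_inv_pop[OF inv_s lt]
        by (intro relax_ok[OF fr1]) (auto simp: arr adjacency_def)
      then show ?thesis
      proof (rule ok_mono)
        fix s' assume s': "keeps {2, 3, 4, 5, 6, 16, 20, 23, 24, 25, 30} {0, 2, 3, 4} s1 s' \<and>
          bfs_inv X (snd s' 5) (snd s' 6) (fst s' 19) (Suc ?h) 0 \<and> (\<forall>i<Suc ?h. snd s' 5 i = snd s1 5 i)"
        have h': "fst s' 20 = Suc ?h" using s' s1 by (auto simp: keeps_def)
        have "keeps {2, 3, 4, 5, 6, 16, 23, 24, 25, 30} {0, 2, 3, 4} s s1" using s1 by (simp add: keeps_def)
        then have k: "keeps {2, 3, 4, 5, 6, 16, 23, 24, 25, 30} {0, 2, 3, 4} s0 s'"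
          using s' I by (auto simp: keeps_def)
        have "snd s' 5 ` {..<Suc ?h} = snd s 5 ` {..<Suc ?h}"
          using s' arr by (intro image_cong) auto
        then have q': "snd s' 5 ` {..<Suc ?h} = insert ?u (snd s 5 ` {..<?h})"
          by (simp add: lessThan_Suc)
        \<comment> \<open>The queue is injective, so \<open>?u\<close> was not removed before and
          its edges are charged only once.\<close>
        have "?u \<notin> snd s 5 ` {..<?h}"
          using inj_on_image_mem_iff[of "snd s 5" "{..<fst s 19}" ?h "{..<?h}"] inv_s lt
          by (simp add: bfs_inv_def)
        then have "\<forall>i<?h. snd s 5 i \<noteq> ?u" by (metis imageI lessThan_iff)
        then have "?U (snd s 5) ?h = ?U (snd s' 5) (Suc ?h) \<union> {e. e < m \<and> src e = ?u}"
          and "?U (snd s' 5) (Suc ?h) \<inter> {e. e < m \<and> src e = ?u} = {}"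
          unfolding q' by auto
        then have "card (?U (snd s 5) ?h) = card (?U (snd s' 5) (Suc ?h)) + ?deg"
          by (simp add: card_Un_disjoint)
        then show "?I s' \<and> 18 * ?deg + 10 + ?\<Phi> s' \<le> ?\<Phi> s"
          using s' k h' hn by simp
      qed simp
    qed
    ultimately have "ok (pop ;; CWhile 2 8 (relax bw)) (8 + (18 * ?deg + 1)) s
        (\<lambda>s'. ?I s' \<and> 18 * ?deg + 10 + ?\<Phi> s' \<le> ?\<Phi> s)"
      by (rule ok_seq)
    then show "\<exists>K. ok (pop ;; CWhile 2 8 (relax bw)) K s (\<lambda>s'. ?I s' \<and> K + 1 + ?\<Phi> s' \<le> ?\<Phi> s)"
      by (intro exI[of _ "8 + (18 * ?deg + 1)"]) (simp add: ac_simps)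
  next
    show "?I ?s" using inv by (simp add: keeps_def)
  qed simp_all
  have "card (?U (snd ?s 5) (fst ?s 20)) = m" by simp
  then have "ok (search bw) (1 + (20 * m + 20 * n + 1)) s0 (\<lambda>s'. ?I s' \<and> \<not> fst s' 20 < fst s' 19)"
    unfolding search_def using loop word_bound by (intro ok_const_seq) simp_all
  then show ?thesis
    by (rule ok_mono) (auto simp: bfs_inv_def)
qed

definition far :: "nat set \<Rightarrow> nat set" where
  "far X = sdist E X ` ({..<n} - S)"

lemma scan_ok:
  assumes fr: "frame n m I s0" and d: "\<forall>v<n. snd s0 6 v = sdist E X v" and le: "\<forall>v<n. sdist E X v \<le> n"
  shows "ok (scan bw) (13 * n + 3) s0
    (\<lambda>s. keeps {2, 3, 4, 5, 6, 16, 23, 24, 25} {0, 2, 3, 4} s0 s \<and> (\<forall>v<n. snd s 6 v = 0) \<and>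
      fst s 22 \<le> n \<and> is_max0 (fst s 22) (far X) \<and> (fst s 30 = 0 \<longleftrightarrow> fst s0 30 = 0 \<and> 0 \<notin> far X))"
proof -
  let ?d = "sdist E X"
  let ?D = "\<lambda>i. ?d ` ({..<i} - S)"
  let ?I = "\<lambda>s. keeps {2, 3, 4, 5, 6, 16, 23, 24, 25} {0, 2, 3, 4} s0 s \<and> fst s 8 \<le> n \<and>
    (\<forall>v<n. snd s 6 v = (if v < fst s 8 then 0 else ?d v)) \<and>
    fst s 22 \<le> n \<and> is_max0 (fst s 22) (?D (fst s 8)) \<and> (fst s 30 = 0 \<longleftrightarrow> fst s0 30 = 0 \<and> 0 \<notin> ?D (fst s 8))"
  let ?\<Phi> = "\<lambda>s. 13 * (n - fst s 8)"
  let ?s = "((fst s0)(8 := 0, 22 := 0), snd s0)"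
  have loop: "ok (CWhile 8 4 (scan_body bw)) (?\<Phi> ?s + 1) ?s (\<lambda>s'. ?I s' \<and> \<not> fst s' 8 < fst s' 4)"
  proof (rule ok_while_wp[where I = ?I and \<Phi> = ?\<Phi>])
    fix s assume I: "?I s" and lt: "fst s 8 < fst s 4"
    let ?i = "fst s 8"
    have fr': "fst s 2 = 0" "fst s 3 = 1" "fst s 4 = n" "fst s 5 = m" "fst s 6 = 2 + 2 * m" "snd s 0 = I"
      using fr I by (auto simp: frame_def keeps_def)
    have i: "?i < n" using lt fr' by simp
    have b: "?i < N" "2 + 2 * m + ?i < N" "2 + 2 * m + ?i < 2 ^ w" "?d ?i < 2 ^ w" "Suc ?i < 2 ^ w" "(1::nat) < 2 ^ w"
      using i le word_bound by (auto simp: N_eq intro: le_less_trans[of _ n])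
    have d_i: "snd s 6 ?i = ?d ?i" using I i by simp
    have cost: "cost (scan_body bw) \<le> 12" by (simp add: scan_body_def skip_def)
    have Ii: "I (2 + 2 * m + ?i) = (if (?i \<in> S) = bw then 0 else 1)" using I_S[OF i] .
    have D: "?D (Suc ?i) = (if ?i \<in> S then ?D ?i else insert (?d ?i) (?D ?i))"
      by (auto simp: less_Suc_eq lessThan_Suc insert_Diff_if)
    have "wp N w (scan_body bw) (\<lambda>s'. keeps {2, 3, 4, 5, 6, 16, 23, 24, 25} {0, 2, 3, 4} s s' \<and>
      fst s' 8 = Suc ?i \<and> snd s' 6 = (snd s 6)(?i := 0) \<and>
      fst s' 22 = (if ?i \<notin> S \<and> fst s 22 < ?d ?i then ?d ?i else fst s 22) \<and>
      fst s' 30 = (if ?i \<notin> S \<and> ?d ?i = 0 then 1 else fst s 30)) s"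
      unfolding scan_body_def skip_def
      using b Ii by (cases bw) (simp_all add: fr' d_i keeps_def cong: wp_cong)
    then show "wp N w (scan_body bw) (\<lambda>s'. ?I s' \<and> cost (scan_body bw) + 1 + ?\<Phi> s' \<le> ?\<Phi> s) s"
    proof (rule wp_mono, intro conjI)
      fix s' assume s': "keeps {2, 3, 4, 5, 6, 16, 23, 24, 25} {0, 2, 3, 4} s s' \<and>
        fst s' 8 = Suc ?i \<and> snd s' 6 = (snd s 6)(?i := 0) \<and>
        fst s' 22 = (if ?i \<notin> S \<and> fst s 22 < ?d ?i then ?d ?i else fst s 22) \<and>
        fst s' 30 = (if ?i \<notin> S \<and> ?d ?i = 0 then 1 else fst s 30)"
      show "keeps {2, 3, 4, 5, 6, 16, 23, 24, 25} {0, 2, 3, 4} s0 s'"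
        using s' I by (auto intro: keeps_trans)
      show "fst s' 8 \<le> n" using s' i by simp
      show "\<forall>v<n. snd s' 6 v = (if v < fst s' 8 then 0 else ?d v)"
        using s' I by (auto simp: less_Suc_eq)
      show "fst s' 22 \<le> n" using s' I i le by simp
      show "is_max0 (fst s' 22) (?D (fst s' 8))"
        using s' I is_max0_insert[of "fst s 22" "?D ?i" "?d ?i"] by (simp add: D split: if_splits)
      show "fst s' 30 = 0 \<longleftrightarrow> fst s0 30 = 0 \<and> 0 \<notin> ?D (fst s' 8)"
        using s' I by (simp add: D)
      show "cost (scan_body bw) + 1 + ?\<Phi> s' \<le> ?\<Phi> s"
        using s' i cost by simp
    qed
  next
    show "?I ?s" using d by (simp add: keeps_def is_max0_def)
  qed simp_all
  then have "ok (scan bw) (1 + (1 + (13 * n + 1))) s0 (\<lambda>s'. ?I s' \<and> \<not> fst s' 8 < fst s' 4)"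
    unfolding scan_def using word_bound by (intro ok_const_seq) simp_all
  then show ?thesis
    by (rule ok_mono) (use fr in \<open>auto simp: keeps_def frame_def far_def\<close>)
qed

lemma bfs_ok:
  assumes fr: "frame n m I s0" and adj: "adjacency m s0"
    and lo: "fst s0 17 \<le> fst s0 18" "fst s0 18 \<le> fst s0 16"
    and zero: "\<forall>v<n. snd s0 6 v = 0"
    and X: "X = snd s0 4 ` {fst s0 17..<fst s0 18}"
  shows "ok (bfs bw) (20 * m + 43 * n + 7) s0
    (\<lambda>s. keeps {2, 3, 4, 5, 6, 16, 23, 24, 25} {0, 2, 3, 4} s0 s \<and> (\<forall>v<n. snd s 6 v = 0) \<and>
      fst s 22 \<le> n \<and> is_max0 (fst s 22) (far X) \<and> (fst s 30 = 0 \<longleftrightarrow> fst s0 30 = 0 \<and> 0 \<notin> far X))"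
proof -
  let ?Q = "\<lambda>s. keeps {2, 3, 4, 5, 6, 16, 23, 24, 25, 30} {0, 2, 3, 4} s0 s"
  have Xn: "X \<subseteq> {..<n}"
  proof -
    have "X \<subseteq> snd s0 4 ` {..<fst s0 16}" using lo by (auto simp: X)
    then show ?thesis using adj cut_subset by (auto simp: adjacency_def)
  qed
  have frame_s: "frame n m I s" "adjacency m s" if "?Q s" for s
    using that fr adj by (auto simp: frame_def keeps_def adjacency_def)
  have 1: "ok seed (10 * n + 2) s0 (\<lambda>s. ?Q s \<and> bfs_inv X (snd s 5) (snd s 6) (fst s 19) 0 0)"
    using seed_ok[OF fr adj lo zero] by (simp add: X)
  have 2: "ok (search bw) (20 * m + 20 * n + 2) s
      (\<lambda>s. ?Q s \<and> bfs_inv X (snd s 5) (snd s 6) (fst s 19) (fst s 19) 0)"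
    if "?Q s \<and> bfs_inv X (snd s 5) (snd s 6) (fst s 19) 0 0" for s
    using that frame_s[of s] by (intro ok_mono[OF search_ok]) (auto intro: keeps_trans)
  have 3: "ok (scan bw) (13 * n + 3) s
      (\<lambda>s. keeps {2, 3, 4, 5, 6, 16, 23, 24, 25} {0, 2, 3, 4} s0 s \<and> (\<forall>v<n. snd s 6 v = 0) \<and>
      fst s 22 \<le> n \<and> is_max0 (fst s 22) (far X) \<and> (fst s 30 = 0 \<longleftrightarrow> fst s0 30 = 0 \<and> 0 \<notin> far X))"
    if s: "?Q s \<and> bfs_inv X (snd s 5) (snd s 6) (fst s 19) (fst s 19) 0" for s
  proof -
    have inv: "bfs_inv X (snd s 5) (snd s 6) (fst s 19) (fst s 19) 0" using s by simp
    have d: "snd s 6 v = sdist E X v" if "v < n" for v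
      using bfs_inv_final[OF inv Xn that] .
    \<comment> \<open>A label is at most its queue position plus one; \<open>scan_ok\<close> needs
      the bound to copy labels without overflow.\<close>
    have "snd s 6 v \<le> n" if "v < n" for v
    proof (cases "snd s 6 v = 0")
      case False
      then have "v \<in> snd s 5 ` {..<fst s 19}" using inv that by (simp add: bfs_inv_def)
      then obtain i where "i < fst s 19" "v = snd s 5 i" by auto
      then have "snd s 6 v \<le> Suc i" using inv by (simp add: bfs_inv_def)
      then show ?thesis using \<open>i < fst s 19\<close> bfs_inv_t(1)[OF inv] by simp
    qed simp
    then have "\<forall>v<n. sdist E X v \<le> n" using d by metis
    moreover have "fst s 30 = fst s0 30" using s by (simp add: keeps_def)
    ultimately show ?thesis
      using s frame_s[of s] d by (intro ok_mono[OF scan_ok[where X = X]]) (auto intro: keeps_trans)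
  qed
  have "ok (bfs bw) ((10 * n + 2) + ((20 * m + 20 * n + 2) + (13 * n + 3))) s0
    (\<lambda>s. keeps {2, 3, 4, 5, 6, 16, 23, 24, 25} {0, 2, 3, 4} s0 s \<and> (\<forall>v<n. snd s 6 v = 0) \<and>
      fst s 22 \<le> n \<and> is_max0 (fst s 22) (far X) \<and> (fst s 30 = 0 \<longleftrightarrow> fst s0 30 = 0 \<and> 0 \<notin> far X))"
    unfolding bfs_def by (rule ok_seq[OF 1], rule ok_seq[OF 2]) (use 3 in auto)
  then show ?thesis by (rule ok_mono) simp_all
qed

text \<open>\<open>A\<close> is what register 23 has collected before, so that the second half can
  continue the maximum of the first. In \<open>card (cut m) + 2\<close>, one extra unit pays for
  \<open>clear\<close> and \<open>build\<close>, the other for the search from the whole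
  cut.\<close>

lemma half_ok:
  assumes fr: "frame n m I s0" and A: "is_max0 (fst s0 23) A"
  shows "ok (half bw) ((card (cut m) + 2) * (40 * m + 60 * n + 40)) s0
    (\<lambda>s. keeps {2, 3, 4, 5, 6, 25} {0} s0 s \<and>
      is_max0 (fst s 23) (A \<union> (\<Union>x\<in>cut m. far {x})) \<and> fst s 22 \<le> n \<and> is_max0 (fst s 22) (far (cut m)) \<and>
      (fst s 30 = 0 \<longleftrightarrow> fst s0 30 = 0 \<and> 0 \<notin> far (cut m) \<and> (\<forall>x\<in>cut m. 0 \<notin> far {x})))"
    (is "ok _ _ _ ?post")
proof -
  let ?k = "card (cut m)" and ?B = "20 * m + 43 * n + 7"
  let ?Q1 = "\<lambda>s. keeps {2, 3, 4, 5, 6, 23, 25, 30} {0} s0 s \<and>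
    (\<forall>v<n. snd s 2 v = 0 \<and> snd s 7 v = 0 \<and> snd s 6 v = 0)"
  let ?Q2 = "\<lambda>s. keeps {2, 3, 4, 5, 6, 23, 25, 30} {0} s0 s \<and> (\<forall>v<n. snd s 6 v = 0) \<and> adjacency m s"
  let ?I = "\<lambda>s. keeps {2, 3, 4, 5, 6, 25} {0} s0 s \<and> (\<forall>v<n. snd s 6 v = 0) \<and> adjacency m s \<and>
    fst s 24 \<le> ?k \<and> is_max0 (fst s 23) (A \<union> (\<Union>x\<in>snd s 4 ` {..<fst s 24}. far {x})) \<and>
    (fst s 30 = 0 \<longleftrightarrow> fst s0 30 = 0 \<and> (\<forall>x\<in>snd s 4 ` {..<fst s 24}. 0 \<notin> far {x}))"
  \<comment> \<open>Beyond the search itself: 3 steps for \<open>start\<close>, 2 for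
    \<open>keep_max\<close>, 1 for the test.\<close>
  let ?\<Phi> = "\<lambda>s. (?B + 6) * (?k - fst s 24)"
  have 1: "ok clear (8 * n + 2) s0 ?Q1" using clear_ok[OF fr] .
  have 2: "ok (build bw) (32 * m + 5) s ?Q2" if s: "?Q1 s" for s
  proof -
    have "frame n m I s" using s fr by (auto simp: frame_def keeps_def)
    then show ?thesis by (rule ok_mono[OF build_ok]) (use s in \<open>auto simp: keeps_def\<close>)
  qed
  have kn: "?k \<le> n" using card_mono[OF _ cut_subset] by simp
  have loop: "ok (CWhile 24 16 (start ;; bfs bw ;; keep_max)) (?\<Phi> s + 1) s
      (\<lambda>s'. ?I s' \<and> \<not> fst s' 24 < fst s' 16)" if "?I s" for s
  proof (rule ok_while[where I = ?I and \<Phi> = ?\<Phi>])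
    fix s assume I: "?I s" and lt: "fst s 24 < fst s 16"
    let ?c = "fst s 24" and ?L = "snd s 4"
    let ?X = "{?L ?c}"
    have fr_s: "frame n m I s" using fr I by (auto simp: frame_def keeps_def)
    have adj: "adjacency m s" using I by simp
    have k: "fst s 16 = ?k" using adjacency_count(1)[OF adj] by simp
    have fr': "fst s 2 = 0" "fst s 3 = 1" using fr_s by (simp_all add: frame_def)
    let ?R1 = "\<lambda>s'. keeps {2, 3, 4, 5, 6, 16, 23, 25, 30} {0, 2, 3, 4, 6} s s' \<and> fst s' 17 = ?c \<and>
      fst s' 18 = Suc ?c \<and> fst s' 24 = Suc ?c"
    let ?R2 = "\<lambda>s'. keeps {2, 3, 4, 5, 6, 16, 23, 25} {0, 2, 3, 4} s s' \<and> fst s' 24 = Suc ?c \<and>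
      (\<forall>v<n. snd s' 6 v = 0) \<and> fst s' 22 \<le> n \<and> is_max0 (fst s' 22) (far ?X) \<and>
      (fst s' 30 = 0 \<longleftrightarrow> fst s 30 = 0 \<and> 0 \<notin> far ?X)"
    let ?R3 = "\<lambda>s'. ?I s' \<and> fst s' 24 = Suc ?c"
    have r1: "ok start 3 s ?R1"
    proof (rule ok_mono[OF ok_wp])
      show "wp N w start ?R1 s"
        unfolding start_def using lt k kn word_bound by (simp add: fr' keeps_def cong: wp_cong)
    qed (simp_all add: start_def)
    have r2: "ok (bfs bw) ?B s1 ?R2" if s1: "?R1 s1" for s1
    proof (rule ok_mono[OF bfs_ok[where X = ?X]])
      show "frame n m I s1" using s1 fr_s by (auto simp: frame_def keeps_def)
      show "adjacency m s1" "fst s1 17 \<le> fst s1 18" "fst s1 18 \<le> fst s1 16"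
        "\<forall>v<n. snd s1 6 v = 0" "?X = snd s1 4 ` {fst s1 17..<fst s1 18}"
        using s1 adj lt I by (simp_all add: keeps_def adjacency_def)
    next
      fix s' assume "keeps {2, 3, 4, 5, 6, 16, 23, 24, 25} {0, 2, 3, 4} s1 s' \<and> (\<forall>v<n. snd s' 6 v = 0) \<and>
        fst s' 22 \<le> n \<and> is_max0 (fst s' 22) (far ?X) \<and> (fst s' 30 = 0 \<longleftrightarrow> fst s1 30 = 0 \<and> 0 \<notin> far ?X)"
      then show "?R2 s'" using s1 by (auto simp: keeps_def)
    qed simp
    have r3: "ok keep_max 2 s2 ?R3" if s2: "?R2 s2" for s2
    proof (rule ok_mono[OF ok_wp])
      have L: "snd s2 4 = ?L" using s2 by (simp add: keeps_def)
      have im: "?L ` {..<Suc ?c} = insert (?L ?c) (?L ` {..<?c})" by (simp add: lessThan_Suc)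
      have "wp N w keep_max (\<lambda>s'. keeps {2, 3, 4, 5, 6, 16, 24, 25, 30} {0, 2, 3, 4, 6} s2 s' \<and>
        fst s' 23 = (if fst s2 23 < fst s2 22 then fst s2 22 else fst s2 23)) s2"
        unfolding keep_max_def skip_def
        using s2 word_bound fr' by (simp add: keeps_def cong: wp_cong)
      then show "wp N w keep_max ?R3 s2"
      proof (rule wp_mono, intro conjI)
        fix s' assume s': "keeps {2, 3, 4, 5, 6, 16, 24, 25, 30} {0, 2, 3, 4, 6} s2 s' \<and>
          fst s' 23 = (if fst s2 23 < fst s2 22 then fst s2 22 else fst s2 23)"
        show "keeps {2, 3, 4, 5, 6, 25} {0} s0 s'" "\<forall>v<n. snd s' 6 v = 0" "fst s' 24 = Suc ?c"
          using s' s2 I by (auto simp: keeps_def)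
        then show "fst s' 24 \<le> ?k" using lt k by simp
        show "adjacency m s'" using s' s2 adj by (auto simp: adjacency_def keeps_def)
        have "is_max0 (fst s2 23) (A \<union> (\<Union>x\<in>?L ` {..<?c}. far {x}))" "is_max0 (fst s2 22) (far ?X)"
          using s2 I by (auto simp: keeps_def)
        note is_max0_Un[OF this]
        moreover have "snd s' 4 ` {..<fst s' 24} = insert (?L ?c) (?L ` {..<?c})"
          using s' s2 im by (simp add: keeps_def)
        ultimately show "is_max0 (fst s' 23) (A \<union> (\<Union>x\<in>snd s' 4 ` {..<fst s' 24}. far {x}))"
          "fst s' 30 = 0 \<longleftrightarrow> fst s0 30 = 0 \<and> (\<forall>x\<in>snd s' 4 ` {..<fst s' 24}. 0 \<notin> far {x})"
          using s' s2 I by (auto simp: keeps_def ac_simps)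
      qed
    qed ((assumption | simp add: keep_max_def skip_def)+)
    have "ok (start ;; bfs bw ;; keep_max) (3 + (?B + 2)) s ?R3"
      by (rule ok_seq[OF r1], rule ok_seq[OF r2]) (use r3 in auto)
    then have "ok (start ;; bfs bw ;; keep_max) (?B + 5) s
        (\<lambda>s'. ?I s' \<and> ?B + 5 + 1 + ?\<Phi> s' \<le> ?\<Phi> s)"
    proof (rule ok_mono)
      fix s' assume s': "?R3 s'"
      have "?k - ?c = Suc (?k - Suc ?c)" using lt k by simp
      then have "?B + 5 + 1 + ?\<Phi> s' \<le> ?\<Phi> s" using s' by simp
      moreover have "?I s'" using s' by blast
      ultimately show "?I s' \<and> ?B + 5 + 1 + ?\<Phi> s' \<le> ?\<Phi> s" by blast
    qed simp
    then show "\<exists>K. ok (start ;; bfs bw ;; keep_max) K s (\<lambda>s'. ?I s' \<and> K + 1 + ?\<Phi> s' \<le> ?\<Phi> s)"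
      by (rule exI[of _ "?B + 5"])
  qed (use that in simp_all)
  have 3: "ok (CConst 24 0 ;; CWhile 24 16 (start ;; bfs bw ;; keep_max) ;; CConst 17 0 ;; CAdd 18 16 2 ;; bfs bw)
      (1 + (((?B + 6) * ?k + 1) + (1 + (1 + ?B)))) s ?post" if s: "?Q2 s" for s
  proof (intro ok_const_seq)
    let ?s = "((fst s)(24 := 0), snd s)"
    have "?I ?s" using s A by (auto simp: keeps_def adjacency_def)
    from loop[OF this] have l: "ok (CWhile 24 16 (start ;; bfs bw ;; keep_max)) ((?B + 6) * ?k + 1) ?s
      (\<lambda>s'. ?I s' \<and> \<not> fst s' 24 < fst s' 16)" by simp
    show "ok (CWhile 24 16 (start ;; bfs bw ;; keep_max) ;; CConst 17 0 ;; CAdd 18 16 2 ;; bfs bw)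
      (((?B + 6) * ?k + 1) + (1 + (1 + ?B))) ?s ?post"
    proof (rule ok_seq[OF l])
      fix s1 assume "?I s1 \<and> \<not> fst s1 24 < fst s1 16"
      then have I: "?I s1" and le: "fst s1 16 \<le> fst s1 24" by auto
      have adj: "adjacency m s1" using I by simp
      have k: "fst s1 16 = ?k" using adjacency_count(1)[OF adj] by simp
      then have im: "snd s1 4 ` {..<fst s1 24} = cut m"
        using I le by (simp add: adjacency_def)
      let ?s1 = "((fst s1)(17 := 0, 18 := fst s1 16), snd s1)"
      have fr1: "frame n m I s1" using fr I by (auto simp: frame_def keeps_def)
      have "ok (bfs bw) ?B ?s1 ?post"
      proof (rule ok_mono[OF bfs_ok[where X = "cut m"]])
        show "cut m = snd ?s1 4 ` {fst ?s1 17..<fst ?s1 18}"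
          using adj by (simp add: adjacency_def lessThan_atLeast0)
      next
        fix s' assume "keeps {2, 3, 4, 5, 6, 16, 23, 24, 25} {0, 2, 3, 4} ?s1 s' \<and> (\<forall>v<n. snd s' 6 v = 0) \<and>
          fst s' 22 \<le> n \<and> is_max0 (fst s' 22) (far (cut m)) \<and> (fst s' 30 = 0 \<longleftrightarrow> fst ?s1 30 = 0 \<and> 0 \<notin> far (cut m))"
        then show "?post s'" using I im by (auto simp: keeps_def)
      qed (use fr1 adj I in \<open>auto simp: frame_def adjacency_def\<close>)
      moreover have "fst s1 2 = 0" "fst s1 16 < 2 ^ w"
        using fr1 k kn word_bound by (simp_all add: frame_def)
      ultimately have "ok (CAdd 18 16 2 ;; bfs bw) (cost (CAdd 18 16 2) + ?B) ((fst s1)(17 := 0), snd s1) ?post"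
        by (intro ok_wp_seq) simp
      then show "ok (CConst 17 0 ;; CAdd 18 16 2 ;; bfs bw) (1 + (1 + ?B)) s1 ?post"
        by (intro ok_const_seq) simp_all
    qed
  qed (use word_bound in simp_all)
  have "ok (half bw) ((8 * n + 2) + ((32 * m + 5) + (1 + (((?B + 6) * ?k + 1) + (1 + (1 + ?B)))))) s0 ?post"
    unfolding half_def by (rule ok_seq[OF 1], rule ok_seq[OF 2]) (use 3 in auto)
  then show ?thesis
  proof (rule ok_mono)
    have "(?B + 6) * ?k \<le> (40 * m + 60 * n + 40) * ?k" by (intro mult_le_mono1) simp
    then show "(8 * n + 2) + ((32 * m + 5) + (1 + (((?B + 6) * ?k + 1) + (1 + (1 + ?B)))))
      \<le> (?k + 2) * (40 * m + 60 * n + 40)"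
      by (simp add: algebra_simps)
  qed
qed

end

section \<open>Correctness of the estimate\<close>

text \<open>Peel off the last edge: either it crosses, or its source already lies outside
  \<open>S\<close> and the shorter walk crosses.\<close>

lemma relpow_crossing:
  assumes "(s, t) \<in> E ^^ k" "s \<in> S" "t \<notin> S"
  obtains i j u v where "(s, u) \<in> E ^^ i" "(u, v) \<in> E" "u \<in> S" "v \<notin> S" "(v, t) \<in> E ^^ j" "k = i + 1 + j"
proof -
  have "\<exists>i j u v. (s, u) \<in> E ^^ i \<and> (u, v) \<in> E \<and> u \<in> S \<and> v \<notin> S \<and> (v, t) \<in> E ^^ j \<and> k = i + 1 + j"
    using assms
  proof (induction k arbitrary: t)
    case 0
    then show ?case by simp
  next
    case (Suc k)
    then obtain y where y: "(s, y) \<in> E ^^ k" "(y, t) \<in> E" by auto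
    show ?case
    proof (cases "y \<in> S")
      case True
      then show ?thesis using y Suc.prems
        by (intro exI[of _ k] exI[of _ 0] exI[of _ y] exI[of _ t]) simp
    next
      case False
      then obtain i j u v where *: "(s, u) \<in> E ^^ i" "(u, v) \<in> E" "u \<in> S" "v \<notin> S" "(v, y) \<in> E ^^ j" "k = i + 1 + j"
        using Suc.IH[of y] Suc.prems y by blast
      then have "(v, t) \<in> E ^^ Suc j" using y by auto
      then show ?thesis using *
        by (intro exI[of _ i] exI[of _ "Suc j"] exI[of _ u] exI[of _ v]) simp
    qed
  qed
  then show ?thesis using that by blast
qed

lemma relpow_trans_add: "(x, y) \<in> E ^^ i \<Longrightarrow> (y, z) \<in> E ^^ j \<Longrightarrow> (x, z) \<in> E ^^ (i + j)"
  by (auto simp: relpow_add)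

lemma relpow_converse: "(E\<inverse>) ^^ k = (E ^^ k)\<inverse>" for E :: "'a rel"
  by (induction k) (simp_all add: converse_relcomp[symmetric] relpow_commute)

locale cut_estimate =
  fixes E :: "nat rel" and S T :: "nat set"
  assumes disjoint: "S \<inter> T = {}" and edges: "E \<subseteq> (S \<union> T) \<times> (S \<union> T)"
    and nonempty: "S \<noteq> {}" "T \<noteq> {}"
begin

definition S' :: "nat set" where "S' = {u \<in> S. \<exists>v\<in>T. (u, v) \<in> E}"
definition T' :: "nat set" where "T' = {v \<in> T. \<exists>u\<in>S. (u, v) \<in> E}"

text \<open>This is what a zero in register 30 reports after both halves. It forces S' and T' to be
  nonempty.\<close>

definition finite_case :: bool where
  "finite_case \<longleftrightarrow> 0 \<notin> sdist E S' ` T \<and> 0 \<notin> sdist (E\<inverse>) T' ` S \<and>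
     (\<forall>x\<in>S'. 0 \<notin> sdist E {x} ` T) \<and> (\<forall>y\<in>T'. 0 \<notin> sdist (E\<inverse>) {y} ` S)"

lemma walk_from_converse: "walk_from (E\<inverse>) X k v \<longleftrightarrow> (\<exists>x\<in>X. (v, x) \<in> E ^^ k)"
  by (simp add: walk_from_def relpow_converse)

lemma crossing:
  assumes "(s, t) \<in> E ^^ k" "s \<in> S" "t \<in> T"
  obtains i j u v where "(s, u) \<in> E ^^ i" "(u, v) \<in> E" "u \<in> S'" "v \<in> T'" "(v, t) \<in> E ^^ j" "k = i + 1 + j"
proof -
  have "t \<notin> S" using assms(3) disjoint by blast
  with assms(1,2) obtain i j u v
    where *: "(s, u) \<in> E ^^ i" "(u, v) \<in> E" "u \<in> S" "v \<notin> S" "(v, t) \<in> E ^^ j" "k = i + 1 + j"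
    by (rule relpow_crossing)
  then have "v \<in> T" using edges by blast
  then have "u \<in> S'" "v \<in> T'" using * by (auto simp: S'_def T'_def)
  then show ?thesis using * that by blast
qed

text \<open>Searches from single vertices measure pairs in \<open>S \<times> T\<close> only. For the
  two set searches S' and T' must be nonempty: any walk from \<open>S\<close> to \<open>T\<close>
  crosses and provides members of both.\<close>

lemma infinite_case:
  assumes "\<not> finite_case"
  shows "\<exists>s\<in>S. \<exists>t\<in>T. \<forall>k. (s, t) \<notin> E ^^ k"
proof (rule ccontr)
  assume "\<not> ?thesis"
  then have reach: "\<exists>k. (s, t) \<in> E ^^ k" if "s \<in> S" "t \<in> T" for s t using that by blast
  have S'T': "S' \<subseteq> S" "T' \<subseteq> T" by (auto simp: S'_def T'_def)
  obtain s t where st: "s \<in> S" "t \<in> T" using nonempty by blast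
  then obtain k where k: "(s, t) \<in> E ^^ k" using reach by blast
  obtain u v where uv: "u \<in> S'" "v \<in> T'" by (rule crossing[OF k st])
  have 1: "sdist E X t \<noteq> 0" if "t \<in> T" "x \<in> X" "x \<in> S'" for X x t
    using reach[of x t] that S'T' by (auto simp: sdist_eq_0 walk_from_def)
  have 2: "sdist (E\<inverse>) X s \<noteq> 0" if "s \<in> S" "y \<in> X" "y \<in> T'" for X y s
    using reach[of s y] that S'T' by (auto simp: sdist_eq_0 walk_from_converse)
  have "finite_case" unfolding finite_case_def
    using 1[of _ u S'] 1[of _ _ "{_}"] 2[of _ v T'] 2[of _ _ "{_}"] uv by (auto simp: image_iff)
  with assms show False by simp
qed

context
  fixes mx b c :: nat
  assumes fin: finite_case
    and mx: "is_max0 mx ((\<Union>x\<in>S'. sdist E {x} ` T) \<union> (\<Union>y\<in>T'. sdist (E\<inverse>) {y} ` S))"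
    and b: "is_max0 b (sdist E S' ` T)" and c: "is_max0 c (sdist (E\<inverse>) T' ` S)"
begin

text \<open>\<open>mx\<close>, \<open>b\<close>, \<open>c\<close> are one more than mu, beta, gamma,
  so \<open>b + c - 3\<close> is beta + gamma - 1. The maximum is one of its two arguments, and each
  has its own witnessing pair.\<close>

lemma estimate_upper:
  "\<exists>s\<in>S. \<exists>t\<in>T. \<forall>k. (s, t) \<in> E ^^ k \<longrightarrow> max (mx - 1) (b + c - 3) \<le> k"
proof (cases "mx - 1 \<le> b + c - 3")
  case True
  \<comment> \<open>The default 0 of \<open>is_max0\<close> is excluded: a nonempty image bounded by
    0 would contain 0, contrary to \<open>finite_case\<close>. So both maxima are attained.\<close>
  have "b \<noteq> 0" "c \<noteq> 0" using b c fin nonempty by (auto simp: is_max0_def finite_case_def image_iff)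
  then obtain s t where st: "t \<in> T" "b = sdist E S' t" "s \<in> S" "c = sdist (E\<inverse>) T' s"
    using b c by (auto simp: is_max0_def)
  have "b + c - 3 \<le> k" if "(s, t) \<in> E ^^ k" for k
  proof -
    obtain i j u v where *: "(s, u) \<in> E ^^ i" "(u, v) \<in> E" "u \<in> S'" "v \<in> T'" "(v, t) \<in> E ^^ j" "k = i + 1 + j"
      by (rule crossing[OF \<open>(s, t) \<in> E ^^ k\<close> st(3,1)])
    \<comment> \<open>The crossing edge is counted on both sides: \<open>b \<le> j + 2\<close> and
      \<open>c \<le> i + 2\<close>, while \<open>k = i + 1 + j\<close>.\<close>
    have "(u, t) \<in> E ^^ (1 + j)" using relpow_trans_add[of u v 1 E t j] * by simp
    then have "b \<le> Suc (1 + j)" unfolding st using * by (intro sdist_le) (auto simp: walk_from_def)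
    moreover have "(s, v) \<in> E ^^ (i + 1)" using relpow_trans_add[of s u i E v 1] * by simp
    then have "c \<le> Suc (i + 1)" unfolding st using * by (intro sdist_le) (auto simp: walk_from_converse)
    ultimately show ?thesis using * by simp
  qed
  then show ?thesis using st True by auto
next
  case False
  then have "mx \<noteq> 0" by simp
  then consider x t where "x \<in> S'" "t \<in> T" "mx = sdist E {x} t" | y s where "y \<in> T'" "s \<in> S" "mx = sdist (E\<inverse>) {y} s"
    using mx by (auto simp: is_max0_def)
  then show ?thesis
  proof cases
    case 1
    have "mx \<le> Suc k" if "(x, t) \<in> E ^^ k" for k
      unfolding 1 using that by (intro sdist_le) (simp add: walk_from_def)
    then show ?thesis using 1 False by (intro bexI[of _ x] bexI[of _ t]) (auto simp: S'_def le_diff_conv)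
  next
    case 2
    have "mx \<le> Suc k" if "(s, y) \<in> E ^^ k" for k
      unfolding 2 using that by (intro sdist_le) (simp add: walk_from_converse)
    then show ?thesis using 2 False by (intro bexI[of _ s] bexI[of _ y]) (auto simp: T'_def le_diff_conv)
  qed
qed

text \<open>
  A shortest path from \<open>S'\<close> to \<open>t\<close> passes through some \<open>v \<in> T'\<close>, and \<open>s\<close> is close to all of \<open>T'\<close>;
  so \<open>d(s, t) \<le> d(s, v) + d(v, t) \<le> (mx - 1) + (b - 2)\<close>. Symmetrically with \<open>c\<close>; now average.
\<close>

lemma estimate_lower:
  assumes "s \<in> S" "t \<in> T"
  shows "\<exists>k. (s, t) \<in> E ^^ k \<and> 2 * k \<le> 3 * max (mx - 1) (b + c - 3)"
proof -
  \<comment> \<open>Two different walks will be bounded; the least length lies below both, so that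
    the bounds can be averaged.\<close>
  define k where "k = (LEAST k. (s, t) \<in> E ^^ k)"
  have le: "k \<le> l" if "(s, t) \<in> E ^^ l" for l
    unfolding k_def using that by (rule Least_le)
  have nz: "sdist E S' t \<noteq> 0" "sdist (E\<inverse>) T' s \<noteq> 0"
    using fin assms by (auto simp: finite_case_def image_iff)
  have sb: "sdist E S' t \<le> b" and sc: "sdist (E\<inverse>) T' s \<le> c"
    using b c assms by (auto simp: is_max0_def)
  obtain x where x: "x \<in> S'" "(x, t) \<in> E ^^ (sdist E S' t - 1)"
    using sdist_walk[OF nz(1)] by (auto simp: walk_from_def)
  have "x \<in> S" using x(1) by (simp add: S'_def)
  obtain i j u v where 1: "v \<in> T'" "(v, t) \<in> E ^^ j" "sdist E S' t - 1 = i + 1 + j"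
    by (rule crossing[OF x(2) \<open>x \<in> S\<close> assms(2)])
  have le_mx: "a \<le> mx" if "a \<in> (\<Union>x\<in>S'. sdist E {x} ` T) \<union> (\<Union>y\<in>T'. sdist (E\<inverse>) {y} ` S)" for a
    using mx that by (rule is_max0_le)
  have "sdist (E\<inverse>) {v} s \<in> sdist (E\<inverse>) {v} ` S" using assms by blast
  then have v: "sdist (E\<inverse>) {v} s \<noteq> 0" "sdist (E\<inverse>) {v} s \<le> mx"
    using fin 1(1) le_mx[of "sdist (E\<inverse>) {v} s"] unfolding finite_case_def by (metis, blast)
  have "(s, v) \<in> E ^^ (sdist (E\<inverse>) {v} s - 1)"
    using sdist_walk[OF v(1)] by (simp add: walk_from_converse)
  then have p1: "(s, t) \<in> E ^^ (sdist (E\<inverse>) {v} s - 1 + j)" using 1 by (blast intro: relpow_trans_add)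
  obtain y where y: "y \<in> T'" "(s, y) \<in> E ^^ (sdist (E\<inverse>) T' s - 1)"
    using sdist_walk[OF nz(2)] by (auto simp: walk_from_converse)
  have "y \<in> T" using y(1) by (simp add: T'_def)
  obtain i' j' u' v' where 2: "u' \<in> S'" "(s, u') \<in> E ^^ i'" "sdist (E\<inverse>) T' s - 1 = i' + 1 + j'"
    by (rule crossing[OF y(2) assms(1) \<open>y \<in> T\<close>])
  have "sdist E {u'} t \<in> sdist E {u'} ` T" using assms by blast
  then have u: "sdist E {u'} t \<noteq> 0" "sdist E {u'} t \<le> mx"
    using fin 2(1) le_mx[of "sdist E {u'} t"] unfolding finite_case_def by (metis, blast)
  have "(u', t) \<in> E ^^ (sdist E {u'} t - 1)"
    using sdist_walk[OF u(1)] by (simp add: walk_from_def)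
  then have p2: "(s, t) \<in> E ^^ (i' + (sdist E {u'} t - 1))" using 2 by (blast intro: relpow_trans_add)
  have "(s, t) \<in> E ^^ k" unfolding k_def using p1 by (rule LeastI)
  moreover have "k \<le> (mx - 1) + (b - 2)" using le[OF p1] v 1 sb by simp
  moreover have "k \<le> (mx - 1) + (c - 2)" using le[OF p2] u 2 sc by simp
  \<comment> \<open>Hence the subtractions do not truncate, and adding both bounds gives
    \<open>2 * k \<le> 2 * (mx - 1) + (b + c - 3) - 1\<close>.\<close>
  moreover have "2 \<le> b" "2 \<le> c" using 1 2 sb sc by simp_all
  ultimately show ?thesis by (intro exI[of _ k]) auto
qed

end

end

section \<open>Library walks, relation powers and the diameter\<close>

lemma awalk_iff_relpow:
  assumes "pair_wf_digraph G" "u \<in> pverts G"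
  shows "(\<exists>p. pre_digraph.awalk (with_proj G) u p v \<and> length p = k) \<longleftrightarrow> (u, v) \<in> parcs G ^^ k"
proof -
  interpret pair_wf_digraph G by fact
  show ?thesis
    using assms(2)
  proof (induction k arbitrary: u)
    case 0
    \<comment> \<open>Power zero relates every element to itself, while an empty library walk needs
      \<open>u\<close> to be a vertex.\<close>
    then show ?case by (auto simp: awalk_def)
  next
    case (Suc k)
    show ?case
    proof
      assume "\<exists>p. awalk u p v \<and> length p = Suc k"
      then obtain e p where p: "awalk u (e # p) v" "length p = k" by (auto simp: length_Suc_conv)
      then have e: "e \<in> parcs G" "fst e = u" "awalk (snd e) p v" by (auto simp: awalk_Cons_iff)
      then have "(snd e, v) \<in> parcs G ^^ k" using Suc.IH p arc_snd_in_verts by blast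
      moreover have "(u, snd e) \<in> parcs G" using e by (metis prod.collapse)
      ultimately show "(u, v) \<in> parcs G ^^ Suc k" by (rule relpow_Suc_I2[rotated])
    next
      assume "(u, v) \<in> parcs G ^^ Suc k"
      then obtain x where x: "(u, x) \<in> parcs G" "(x, v) \<in> parcs G ^^ k" by (rule relpow_Suc_E2)
      then obtain p where "awalk x p v" "length p = k" using Suc.IH in_arcsD2 by blast
      then have "awalk u ((u, x) # p) v \<and> length ((u, x) # p) = Suc k"
        using x by (simp add: awalk_Cons_iff)
      then show "\<exists>p. awalk u p v \<and> length p = Suc k" by blast
    qed
  qed
qed

text \<open>With unit weights the cost of a walk is its length; an unreachable pair gives the
  infimum of the empty set, which is infinity.\<close>

lemma dist_in_eq:
  assumes "pair_wf_digraph G" "u \<in> pverts G"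
  shows "dist_in G u v = (INF k\<in>{k. (u, v) \<in> parcs G ^^ k}. ereal (real k))"
proof -
  interpret pair_wf_digraph G by fact
  have "awalk_cost (\<lambda>_. 1) p = length p" for p by (induction p) auto
  then have "dist_in G u v = (INF p\<in>{p. awalk u p v}. ereal (real (length p)))"
    by (simp add: dist_in_def \<mu>_def)
  also have "\<dots> = (INF k\<in>length ` {p. awalk u p v}. ereal (real k))"
    by (simp add: image_image)
  also have "length ` {p. awalk u p v} = {k. (u, v) \<in> parcs G ^^ k}"
    using awalk_iff_relpow[OF assms] by (auto simp: image_iff) metis
  finally show ?thesis .
qed

lemma ST_diameter_ge:
  assumes "finite S" "finite T" "s \<in> S" "t \<in> T"
  shows "dist_in G s t \<le> ST_diameter G S T"
proof -
  have "dist_in G s t \<le> (MAX t\<in>T. dist_in G s t)" using assms by (intro Max_ge) auto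
  also have "\<dots> \<le> ST_diameter G S T" unfolding ST_diameter_def using assms by (intro Max_ge) auto
  finally show ?thesis .
qed

lemma ST_diameter_attained:
  assumes "finite S" "finite T" "S \<noteq> {}" "T \<noteq> {}"
  obtains s t where "s \<in> S" "t \<in> T" "ST_diameter G S T = dist_in G s t"
proof -
  have "ST_diameter G S T \<in> (\<lambda>s. MAX t\<in>T. dist_in G s t) ` S"
    unfolding ST_diameter_def using assms by (intro Max_in) auto
  then obtain s where s: "s \<in> S" "ST_diameter G S T = (MAX t\<in>T. dist_in G s t)" by auto
  have "(MAX t\<in>T. dist_in G s t) \<in> dist_in G s ` T" using assms by (intro Max_in) auto
  then show ?thesis using s that by auto
qed

section \<open>The main program\<close>

text \<open>Of the 3 subtracted, two are the offsets of the stored distances and one is the crossing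
  edge, which beta and gamma both count.\<close>

definition finish :: cmd where
  "finish = CConst 1 0 ;; CSub 0 23 3 ;; CAdd 25 25 22 ;; CConst 26 3 ;; CSub 25 25 26 ;;
     CIf 0 25 (CAdd 0 25 2) skip ;; CIf 2 30 (CConst 1 1) skip"

definition estimate :: cmd where
  "estimate = half False ;; CAdd 25 22 2 ;; half True ;; finish"

text \<open>With more than \<open>2 * m\<close> vertices some vertex is isolated, and the diameter is infinite.\<close>

definition main :: cmd where
  "main = CAdd 6 5 5 ;; CIf 6 4 (CConst 1 1) (CAdd 6 6 3 ;; CAdd 6 6 3 ;; estimate)"

text \<open>Registers start at 0, so register 2 is the constant 0 and register 100 already the base
  of array 0, the input. The other bases arise by repeated addition.\<close>

definition preamble :: ram_prog where
  "preamble =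
     Seq (Const 3 1) (Seq (Load 4 2) (Seq (Load 5 3)
     (Seq (Add 101 5 5) (Seq (Add 101 101 4) (Seq (Add 101 101 3) (Seq (Add 101 101 3)
     (Seq (Add 102 101 101) (Seq (Add 103 102 101) (Seq (Add 104 103 101)
     (Seq (Add 105 104 101) (Seq (Add 106 105 101) (Add 107 106 101))))))))))))"

locale cut_input = array_machine N w + cut_estimate "set es" S T
  for N w :: nat and es :: "(nat \<times> nat) list" and S T :: "nat set" +
  fixes n :: nat and I :: "nat \<Rightarrow> nat"
  assumes vertices: "S \<union> T = {..<n}"
    and size: "N = 2 + 2 * length es + n"
    and edge_fst: "e < length es \<Longrightarrow> I (2 + 2 * e) = fst (es ! e)"
    and edge_snd: "e < length es \<Longrightarrow> I (3 + 2 * e) = snd (es ! e)"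
    and side: "v < n \<Longrightarrow> I (2 + 2 * length es + v) = of_bool (v \<in> S)"
begin

abbreviation "m \<equiv> length es"

lemma edge_less: "e < m \<Longrightarrow> fst (es ! e) < n \<and> snd (es ! e) < n"
  using edges vertices nth_mem[of e es] by (cases "es ! e") auto

sublocale fwd: directed_half N w n m "\<lambda>e. fst (es ! e)" "\<lambda>e. snd (es ! e)" False S I
  using edge_less edge_fst edge_snd side size by unfold_locales auto

text \<open>Searching backwards from T' is searching forwards in the converse graph from the cut of
  \<open>T\<close>, so endpoints and sides are both exchanged.\<close>

sublocale bwd: directed_half N w n m "\<lambda>e. snd (es ! e)" "\<lambda>e. fst (es ! e)" True T I
proof unfold_locales
  fix v assume "v < n"
  then have "v \<in> T \<longleftrightarrow> v \<notin> S" using vertices disjoint by auto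
  then show "I (2 + 2 * m + v) = (if (v \<in> T) = True then 0 else 1)" using side[OF \<open>v < n\<close>] by simp
qed (use edge_less edge_fst edge_snd size in auto)

lemma edges_fwd: "edges_of m (\<lambda>e. fst (es ! e)) (\<lambda>e. snd (es ! e)) = set es"
  by (auto simp: edges_of_def set_conv_nth)

lemma edges_bwd: "edges_of m (\<lambda>e. snd (es ! e)) (\<lambda>e. fst (es ! e)) = (set es)\<inverse>"
  by (auto simp: edges_of_def set_conv_nth) (metis fst_conv snd_conv)

lemma others: "{..<n} - S = T" "{..<n} - T = S"
  using vertices disjoint by auto

lemma far_fwd: "fwd.far X = sdist (set es) X ` T"
  by (simp add: fwd.far_def edges_fwd others)

lemma far_bwd: "bwd.far X = sdist ((set es)\<inverse>) X ` S"
  by (simp add: bwd.far_def edges_bwd others)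

lemma edge_sides: "(u, v) \<in> set es \<Longrightarrow> (v \<in> T \<longleftrightarrow> v \<notin> S) \<and> (u \<in> T \<longleftrightarrow> u \<notin> S)"
  using edges disjoint by blast

lemma cut_fwd: "fwd.cut m = S'"
  unfolding fwd.cut_eq edges_fwd S'_def using edge_sides by blast

lemma cut_bwd: "bwd.cut m = T'"
  unfolding bwd.cut_eq edges_bwd T'_def using edge_sides by blast

text \<open>Phrased with walk lengths in the naturals, so that reals and infinity enter only with
  the diameter; the factor 2/3 becomes a comparison of \<open>2 * k\<close> with three times the
  output.\<close>

definition correct :: "array_state \<Rightarrow> bool" where
  "correct s \<longleftrightarrow>
     (if fst s 1 = 0
      then (\<exists>a\<in>S. \<exists>b\<in>T. \<forall>k. (a, b) \<in> set es ^^ k \<longrightarrow> fst s 0 \<le> k) \<and>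
           (\<forall>a\<in>S. \<forall>b\<in>T. \<exists>k. (a, b) \<in> set es ^^ k \<and> 2 * k \<le> 3 * fst s 0)
      else \<exists>a\<in>S. \<exists>b\<in>T. \<forall>k. (a, b) \<notin> set es ^^ k)"

text \<open>Counting endpoints leaves a vertex \<open>v\<close> without edges. A walk between
  \<open>v\<close> and a vertex of the opposite side would need an edge at \<open>v\<close>.\<close>

lemma isolated_vertex:
  assumes "2 * m < n"
  shows "\<exists>a\<in>S. \<exists>b\<in>T. \<forall>k. (a, b) \<notin> set es ^^ k"
proof -
  let ?V = "fst ` set es \<union> snd ` set es"
  have "card ?V \<le> card (fst ` set es) + card (snd ` set es)" by (rule card_Un_le)
  also have "\<dots> \<le> card (set es) + card (set es)" by (intro add_mono card_image_le) auto
  also have "\<dots> \<le> 2 * m" using card_length[of es] by simp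
  finally have "card ?V < card {..<n}" using assms by simp
  then have "\<not> {..<n} \<subseteq> ?V" by (meson card_mono finite_Un finite_imageI finite_set not_le)
  then obtain v where v: "v < n" "v \<notin> ?V" by auto
  have no_edge: "(v, y) \<notin> set es" "(y, v) \<notin> set es" for y
    using v(2) by (force simp: image_iff)+
  have out: "(v, x) \<notin> set es ^^ k" if "x \<noteq> v" for x k
  proof
    assume "(v, x) \<in> set es ^^ k"
    then show False using no_edge that by (cases k) (auto elim: relpow_Suc_E2 simp del: relpow.simps(2))
  qed
  have into: "(x, v) \<notin> set es ^^ k" if "x \<noteq> v" for x k
  proof
    assume "(x, v) \<in> set es ^^ k"
    then show False using no_edge that by (cases k) auto
  qed
  show ?thesis
  proof (cases "v \<in> S")
    case True
    obtain t where "t \<in> T" using nonempty by blast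
    then show ?thesis using True out[of t] disjoint by (intro bexI[of _ v] bexI[of _ t]) auto
  next
    case False
    then have "v \<in> T" using v vertices by auto
    obtain s where "s \<in> S" using nonempty by blast
    then show ?thesis using \<open>v \<in> T\<close> into[of s] disjoint by (intro bexI[of _ s] bexI[of _ v]) auto
  qed
qed

abbreviation "half_cost \<equiv> 40 * m + 60 * n + 40"

lemma estimate_ok:
  assumes fr: "frame n m I s0" and init: "fst s0 23 = 0" "fst s0 30 = 0"
  shows "ok estimate ((card S' + card T' + 4) * half_cost + 12) s0 correct"
proof -
  let ?A = "\<Union>x\<in>S'. sdist (set es) {x} ` T" and ?B = "\<Union>y\<in>T'. sdist ((set es)\<inverse>) {y} ` S"
  let ?bS = "sdist (set es) S' ` T" and ?bT = "sdist ((set es)\<inverse>) T' ` S"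
  let ?zS = "0 \<notin> ?bS \<and> (\<forall>x\<in>S'. 0 \<notin> sdist (set es) {x} ` T)"
  let ?zT = "0 \<notin> ?bT \<and> (\<forall>y\<in>T'. 0 \<notin> sdist ((set es)\<inverse>) {y} ` S)"
  let ?Q1 = "\<lambda>s. frame n m I s \<and> is_max0 (fst s 23) ?A \<and> fst s 22 \<le> n \<and> is_max0 (fst s 22) ?bS \<and>
    (fst s 30 = 0 \<longleftrightarrow> ?zS)"
  let ?Q2 = "\<lambda>s. frame n m I s \<and> is_max0 (fst s 23) ?A \<and> fst s 25 \<le> n \<and> is_max0 (fst s 25) ?bS \<and>
    (fst s 30 = 0 \<longleftrightarrow> ?zS)"
  let ?Q3 = "\<lambda>s. frame n m I s \<and> is_max0 (fst s 23) (?A \<union> ?B) \<and> fst s 25 \<le> n \<and> is_max0 (fst s 25) ?bS \<and>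
    fst s 22 \<le> n \<and> is_max0 (fst s 22) ?bT \<and> (fst s 30 = 0 \<longleftrightarrow> ?zS \<and> ?zT)"
  have 1: "ok (half False) ((card S' + 2) * half_cost) s0 ?Q1"
  proof (rule ok_mono)
    show "ok (half False) ((card S' + 2) * half_cost) s0
      (\<lambda>s. keeps {2, 3, 4, 5, 6, 25} {0} s0 s \<and>
      is_max0 (fst s 23) ({} \<union> ?A) \<and> fst s 22 \<le> n \<and> is_max0 (fst s 22) ?bS \<and>
      (fst s 30 = 0 \<longleftrightarrow> fst s0 30 = 0 \<and> ?zS))"
      using fwd.half_ok[OF fr, of "{}"] init by (simp add: cut_fwd far_fwd is_max0_def)
  qed (use fr init in \<open>auto simp: frame_def keeps_def\<close>)
  have 2: "ok (CAdd 25 22 2) 1 s ?Q2" if s: "?Q1 s" for s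
  proof (rule ok_mono[OF ok_wp])
    show "wp N w (CAdd 25 22 2) ?Q2 s"
      using s fwd.word_bound by (simp add: frame_def)
  qed (assumption | simp)+
  have 3: "ok (half True) ((card T' + 2) * half_cost) s ?Q3" if s: "?Q2 s" for s
  proof (rule ok_mono)
    show "ok (half True) ((card T' + 2) * half_cost) s
      (\<lambda>s'. keeps {2, 3, 4, 5, 6, 25} {0} s s' \<and>
      is_max0 (fst s' 23) (?A \<union> ?B) \<and> fst s' 22 \<le> n \<and> is_max0 (fst s' 22) ?bT \<and>
      (fst s' 30 = 0 \<longleftrightarrow> fst s 30 = 0 \<and> ?zT))"
      using bwd.half_ok[of s ?A] s by (simp only: cut_bwd far_bwd)
  next
    fix s' assume "keeps {2, 3, 4, 5, 6, 25} {0} s s' \<and>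
      is_max0 (fst s' 23) (?A \<union> ?B) \<and> fst s' 22 \<le> n \<and> is_max0 (fst s' 22) ?bT \<and>
      (fst s' 30 = 0 \<longleftrightarrow> fst s 30 = 0 \<and> ?zT)"
    moreover from this have "frame n m I s'" "fst s' 25 = fst s 25"
      using s by (auto simp: frame_def keeps_def)
    ultimately show "?Q3 s'" using s by simp
  qed simp
  have 4: "ok finish 11 s correct" if s: "?Q3 s" for s
  proof (rule ok_mono[OF ok_wp])
    let ?out = "max (fst s 23 - 1) (fst s 25 + fst s 22 - 3)"
    have fin: "finite_case \<longleftrightarrow> ?zS \<and> ?zT" unfolding finite_case_def by blast
    have "wp N w finish (\<lambda>s' :: array_state. fst s' 0 = ?out \<and> (fst s' 1 = 0 \<longleftrightarrow> fst s 30 = 0)) s"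
      unfolding finish_def skip_def
      using s fwd.word_bound by (auto simp: frame_def max_def cong: wp_cong)
    then show "wp N w finish correct s"
    proof (rule wp_mono)
      fix s' :: array_state assume s': "fst s' 0 = ?out \<and> (fst s' 1 = 0 \<longleftrightarrow> fst s 30 = 0)"
      show "correct s'"
      proof (cases finite_case)
        case True
        then have "fst s' 1 = 0" using s s' fin by simp
        then show ?thesis
          using s s' estimate_upper[OF True, of "fst s 23" "fst s 25" "fst s 22"]
            estimate_lower[OF True, of "fst s 23" "fst s 25" "fst s 22"]
          unfolding correct_def by simp
      next
        case False
        then have "fst s' 1 \<noteq> 0" using s s' fin by simp
        then show ?thesis using infinite_case[OF False] by (simp add: correct_def)
      qed
    qed
  qed (assumption | simp add: finish_def skip_def)+
  have "ok estimate ((card S' + 2) * half_cost + (1 + ((card T' + 2) * half_cost + 11))) s0 correct"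
    unfolding estimate_def
    by (rule ok_seq[OF 1], rule ok_seq[OF 2], assumption, rule ok_seq[OF 3], assumption, rule 4)
  then show ?thesis by (rule ok_mono) (simp_all add: algebra_simps)
qed

lemma main_ok:
  assumes "fst s0 2 = 0" "fst s0 3 = 1" "fst s0 4 = n" "fst s0 5 = m" "snd s0 0 = I"
    and "fst s0 23 = 0" "fst s0 30 = 0"
  shows "ok main ((card S' + card T' + 4) * (160 * m + 40) + 20) s0 correct"
proof -
  let ?s1 = "((fst s0)(6 := 2 * m), snd s0)"
  have "ok (CIf 6 4 (CConst 1 1) (CAdd 6 6 3 ;; CAdd 6 6 3 ;; estimate))
    (Suc ((card S' + card T' + 4) * (160 * m + 40) + 18)) ?s1 correct"
  proof (rule ok_if)
    assume "fst ?s1 6 < fst ?s1 4"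
    then have "2 * m < n" using assms by simp
    then have "wp N w (CConst 1 1) correct ?s1"
      using isolated_vertex fwd.word_bound by (simp add: correct_def)
    then show "ok (CConst 1 1) ((card S' + card T' + 4) * (160 * m + 40) + 18) ?s1 correct"
      by (rule ok_mono[OF ok_wp]) simp_all
  next
    assume "\<not> fst ?s1 6 < fst ?s1 4"
    then have n: "n \<le> 2 * m" using assms by simp
    let ?s = "((fst s0)(6 := 2 + 2 * m), snd s0)"
    \<comment> \<open>\<open>n \<le> 2 * m\<close> turns \<open>60 * n\<close> into
      \<open>120 * m\<close>.\<close>
    have "(card S' + card T' + 4) * half_cost \<le> (card S' + card T' + 4) * (160 * m + 40)"
      using n by (intro mult_le_mono2) simp
    moreover have "ok estimate ((card S' + card T' + 4) * half_cost + 12) ?s correct"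
      using assms by (intro estimate_ok) (simp_all add: frame_def)
    ultimately have "ok estimate ((card S' + card T' + 4) * (160 * m + 40) + 12) ?s correct"
      by (elim ok_mono) simp
    then have "ok (CAdd 6 6 3 ;; CAdd 6 6 3 ;; estimate)
        (1 + (1 + ((card S' + card T' + 4) * (160 * m + 40) + 12))) ?s1 correct"
      using assms fwd.word_bound
      by (intro ok_add_seq[where v = "2 * m + 1"] ok_add_seq[where v = "2 + 2 * m"]) simp_all
    then show "ok (CAdd 6 6 3 ;; CAdd 6 6 3 ;; estimate)
        ((card S' + card T' + 4) * (160 * m + 40) + 18) ?s1 correct"
      by (rule ok_mono) simp_all
  qed simp_all
  then have "ok main (1 + Suc ((card S' + card T' + 4) * (160 * m + 40) + 18)) s0 correct"
    unfolding main_def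
    using assms fwd.word_bound by (intro ok_add_seq[where v = "2 * m"]) simp_all
  then show ?thesis by (rule ok_mono) simp_all
qed

end

section \<open>Execution of the preamble and layout of the input\<close>

lemma exec_seq: "ram_exec w p s 1 s' \<Longrightarrow> ram_exec w q s' k s'' \<Longrightarrow> ram_exec w (Seq p q) s (Suc k) s''"
  using ram_exec.intros(6)[of w p s 1 s' q k s''] by simp

lemma exec_add: "R a + R b < 2 ^ w \<Longrightarrow> R' = R(r := R a + R b) \<Longrightarrow> ram_exec w (Add r a b) (R, M) 1 (R', M)"
  using ram_exec.intros(2)[of w r a b R M] by simp

lemma preamble_exec:
  assumes N: "N = 2 + 2 * M 1 + M 0" and w: "8 * N \<le> 2 ^ w"
  shows "\<exists>R. ram_exec w preamble (\<lambda>_. 0, M) 13 (R, M) \<and>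
    (\<forall>r<99. R r = ((\<lambda>_. 0)(3 := 1, 4 := M 0, 5 := M 1)) r) \<and> (\<forall>j<8. R (100 + j) = j * N)"
proof -
  define R0 :: "nat \<Rightarrow> nat" where "R0 = (\<lambda>_. 0)(3 := 1, 4 := M 0, 5 := M 1)"
  have R0: "R0 3 = 1" "R0 4 = M 0" "R0 5 = M 1" by (simp_all add: R0_def)
  have pos: "0 < N" and pos8: "1 < 8 * N" using N by simp_all
  have one: "1 < (2 :: nat) ^ w" using pos8 w by (rule less_le_trans)
  have 1: "ram_exec w (Const 3 1) (\<lambda>_. 0, M) 1 ((\<lambda>_. 0)(3 := 1), M)"
    using ram_exec.intros(1)[of w 3 1 "\<lambda>_. 0" M] unfolding mod_less[OF one] .
  have 2: "ram_exec w (Load 4 2) ((\<lambda>_. 0)(3 := 1), M) 1 ((\<lambda>_. 0)(3 := 1, 4 := M 0), M)"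
    using ram_exec.intros(4)[of w 4 2 "(\<lambda>_. 0)(3 := 1)" M] by simp
  have 3: "ram_exec w (Load 5 3) ((\<lambda>_. 0)(3 := 1, 4 := M 0), M) 1 (R0, M)"
    using ram_exec.intros(4)[of w 5 3 "(\<lambda>_. 0)(3 := 1, 4 := M 0)" M] by (simp add: R0_def)
  let ?R = "R0(101 := N, 102 := 2 * N, 103 := 3 * N, 104 := 4 * N, 105 := 5 * N, 106 := 6 * N, 107 := 7 * N)"
  have "ram_exec w preamble (\<lambda>_. 0, M) (Suc (Suc (Suc (Suc (Suc (Suc (Suc (Suc (Suc (Suc (Suc (Suc 1)))))))))))) (?R, M)"
    unfolding preamble_def
    apply (rule exec_seq[OF 1], rule exec_seq[OF 2], rule exec_seq[OF 3])
    apply (rule exec_seq[OF exec_add[where R' = "R0(101 := 2 * M 1)"]])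
      apply (use R0 N w in \<open>simp_all add: mult_2\<close>)[2]
    apply (rule exec_seq[OF exec_add[where R' = "R0(101 := 2 * M 1 + M 0)"]])
      apply (use R0 N w in \<open>simp_all\<close>)[2]
    apply (rule exec_seq[OF exec_add[where R' = "R0(101 := 2 * M 1 + M 0 + 1)"]])
      apply (use R0 N w in \<open>simp_all\<close>)[2]
    apply (rule exec_seq[OF exec_add[where R' = "R0(101 := N)"]])
      apply (use R0 N w in \<open>simp_all\<close>)[2]
    apply (rule exec_seq[OF exec_add[where R' = "R0(101 := N, 102 := 2 * N)"]])
      apply (use w pos in \<open>simp_all add: mult_2\<close>)[2]
    apply (rule exec_seq[OF exec_add[where R' = "R0(101 := N, 102 := 2 * N, 103 := 3 * N)"]])
      apply (use w pos in \<open>simp_all\<close>)[2]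
    apply (rule exec_seq[OF exec_add[where R' = "R0(101 := N, 102 := 2 * N, 103 := 3 * N, 104 := 4 * N)"]])
      apply (use w pos in \<open>simp_all\<close>)[2]
    apply (rule exec_seq[OF exec_add[where R' = "R0(101 := N, 102 := 2 * N, 103 := 3 * N, 104 := 4 * N, 105 := 5 * N)"]])
      apply (use w pos in \<open>simp_all\<close>)[2]
    apply (rule exec_seq[OF exec_add[where R' = "R0(101 := N, 102 := 2 * N, 103 := 3 * N, 104 := 4 * N, 105 := 5 * N, 106 := 6 * N)"]])
      apply (use w pos in \<open>simp_all\<close>)[2]
    apply (rule exec_add)
     apply (use w pos in \<open>simp_all\<close>)
    done
  then have "ram_exec w preamble (\<lambda>_. 0, M) 13 (?R, M)" by (simp add: numeral_eq_Suc)
  moreover have "\<forall>r<99. ?R r = R0 r" by auto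
  moreover have "\<forall>j<8. ?R (100 + j) = j * N"
    by (auto simp: less_Suc_eq numeral_eq_Suc R0_def)
  ultimately show ?thesis unfolding R0_def by blast
qed

lemma length_concat_pairs: "length (concat (map (\<lambda>(u, v). [u, v]) es)) = 2 * length es"
  by (induction es) auto

lemma nth_concat_pairs:
  assumes "e < length es"
  shows "concat (map (\<lambda>(u, v). [u, v]) es) ! (2 * e) = fst (es ! e)"
    and "concat (map (\<lambda>(u, v). [u, v]) es) ! Suc (2 * e) = snd (es ! e)"
  using assms
proof (induction es arbitrary: e)
  case (Cons p es)
  {
    case 1
    then show ?case using Cons.IH(1)[of "e - 1"] by (cases e; cases p) auto
  next
    case 2
    then show ?case using Cons.IH(2)[of "e - 1"] by (cases e; cases p) auto
  }
qed simp_all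

lemma length_encode_input: "length (encode_input n es S) = 2 + 2 * length es + n"
  by (simp add: encode_input_def length_concat_pairs)

lemma nth_encode_input:
  "encode_input n es S ! 0 = n" "encode_input n es S ! 1 = length es"
  "e < length es \<Longrightarrow> encode_input n es S ! (2 + 2 * e) = fst (es ! e)"
  "e < length es \<Longrightarrow> encode_input n es S ! (3 + 2 * e) = snd (es ! e)"
  "v < n \<Longrightarrow> encode_input n es S ! (2 + 2 * length es + v) = of_bool (v \<in> S)"
  by (simp_all add: encode_input_def nth_append length_concat_pairs nth_concat_pairs numeral_3_eq_3)

theorem theorem32:
  shows "\<exists>(P :: ram_prog) (c :: nat).
    \<forall>(G :: nat pair_pre_digraph) (n :: nat) (es :: (nat \<times> nat) list) (S :: nat set) (T :: nat set) (w :: nat).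
      pair_fin_digraph G \<longrightarrow> pverts G = {..<n} \<longrightarrow>
      distinct es \<longrightarrow> set es = parcs G \<longrightarrow>
      S \<subseteq> pverts G \<longrightarrow> T = pverts G - S \<longrightarrow> S \<noteq> {} \<longrightarrow> T \<noteq> {} \<longrightarrow>
      c * length (encode_input n es S) \<le> 2 ^ w \<longrightarrow>
      (let m = card (parcs G); B' = boundary G S T in
       \<exists>k s. ram_exec w P (ram_init (encode_input n es S)) k s \<and>
             k \<le> c * (if B' = {} then m + 1 else m * card B') \<and>
             ereal (2 / 3) * ST_diameter G S T \<le> ram_output s \<and>
             ram_output s \<le> ST_diameter G S T)"
proof (intro exI[of _ "Seq preamble (compile main)"] exI[of _ 1100] allI impI)
  fix G :: "nat pair_pre_digraph" and n es S T w
  assume G: "pair_fin_digraph G" and verts: "pverts G = {..<n}"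
    and es: "distinct es" "set es = parcs G"
    and S: "S \<subseteq> pverts G" and T: "T = pverts G - S" and ne: "S \<noteq> {}" "T \<noteq> {}"
    and word: "1100 * length (encode_input n es S) \<le> 2 ^ w"
  interpret G: pair_fin_digraph G by fact
  let ?xs = "encode_input n es S" and ?m = "length es"
  define N where "N = 2 + 2 * ?m + n"
  define M where "M = snd (ram_init ?xs)"
  have len: "length ?xs = N" by (simp add: N_def length_encode_input)
  have init: "ram_init ?xs = (\<lambda>_. 0, M)" by (simp add: M_def ram_init_def)
  have M: "M i = ?xs ! i" if "i < N" for i using that len by (simp add: M_def ram_init_def)
  have M01: "M 0 = n" "M 1 = ?m" using M nth_encode_input(1,2) by (simp_all add: N_def)
  have w: "8 * N \<le> 2 ^ w" using word len by simp
  interpret cut_input N w es S T n M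
  proof unfold_locales
    show "8 * N \<le> 2 ^ w" by (rule w)
    show "S \<inter> T = {}" "S \<noteq> {}" "T \<noteq> {}" using T ne by auto
    show "set es \<subseteq> (S \<union> T) \<times> (S \<union> T)" using es T S G.in_arcsD1 G.in_arcsD2 by auto
    show "S \<union> T = {..<n}" using T S verts by auto
    show "N = 2 + 2 * ?m + n" by (rule N_def)
    show "M (2 + 2 * e) = fst (es ! e)" if "e < ?m" for e
      using M[of "2 + 2 * e"] nth_encode_input(3)[OF that] that by (simp add: N_def)
    show "M (3 + 2 * e) = snd (es ! e)" if "e < ?m" for e
      using M[of "3 + 2 * e"] nth_encode_input(4)[OF that] that by (simp add: N_def)
    show "M (2 + 2 * ?m + v) = of_bool (v \<in> S)" if "v < n" for v
      using M[of "2 + 2 * ?m + v"] nth_encode_input(5)[OF that] that by (simp add: N_def)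
  qed
  obtain R where R: "ram_exec w preamble (\<lambda>_. 0, M) 13 (R, M)"
    and Rr: "\<forall>r<99. R r = ((\<lambda>_. 0)(3 := 1, 4 := M 0, 5 := M 1)) r" "\<forall>j<8. R (100 + j) = j * N"
    using preamble_exec[of N M w] w M01 by (auto simp: N_def)
  \<comment> \<open>Each array is a window of the memory; array 0 starts at address 0 and thus shows
    the input.\<close>
  let ?s0 = "((\<lambda>_. 0)(3 := 1, 4 := M 0, 5 := M 1), \<lambda>j i. M (j * N + i)) :: array_state"
  have "represents N ?s0 (R, M)" using Rr by (simp add: represents_def)
  moreover have "ok main ((card S' + card T' + 4) * (160 * ?m + 40) + 20) ?s0 correct"
    by (rule main_ok) (simp_all add: M01[simplified])
  ultimately obtain k s t where k: "ram_exec w (compile main) (R, M) k t"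
    "k \<le> (card S' + card T' + 4) * (160 * ?m + 40) + 20" "represents N s t" "correct s"
    unfolding ok_def by blast
  have exec: "ram_exec w (Seq preamble (compile main)) (ram_init ?xs) (13 + k) t"
    unfolding init by (rule ram_exec.intros(6)[OF R k(1)])
  have m: "card (parcs G) = ?m" using es distinct_card by metis
  have B: "boundary G S T = S' \<union> T'" unfolding boundary_def S'_def T'_def es(2)[symmetric] ..
  have fin: "finite S" "finite T" using S T verts by (auto intro: finite_subset)
  have "finite S'" "finite T'" "S' \<inter> T' = {}" using fin disjoint by (auto simp: S'_def T'_def)
  then have cardB: "card (boundary G S T) = card S' + card T'" unfolding B by (rule card_Un_disjoint)
  \<comment> \<open>With an empty boundary there remain at most \<open>640 * m + 193\<close> steps;
    as \<open>m\<close> may be 0, the bound is stated with \<open>m + 1\<close>.\<close>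
  have time: "13 + k \<le> 1100 * (if boundary G S T = {} then ?m + 1 else ?m * card (boundary G S T))"
  proof (cases "boundary G S T = {}")
    case True
    then show ?thesis using k(2) B by simp
  next
    case False
    define K where "K = card S' + card T'"
    define q where "q = ?m * K"
    have "K \<ge> 1"
      unfolding K_def cardB[symmetric] using False B \<open>finite S'\<close> \<open>finite T'\<close>
      by (metis One_nat_def Suc_leI card_gt_0_iff finite_UnI)
    moreover obtain p where "p \<in> set es" using False unfolding B S'_def T'_def by blast
    then have "?m \<ge> 1" by (cases es) auto
    \<comment> \<open>A nonempty boundary has an edge, so each term is at most a multiple of
      \<open>q\<close>; the coefficients and the 13 steps of the preamble sum to 1033, which is
      below 1100.\<close>
    ultimately have "1 \<le> q" "?m \<le> q" "K \<le> q" by (simp_all add: q_def Suc_le_eq)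
    moreover have "(K + 4) * (160 * ?m + 40) + 20 = 160 * q + 40 * K + 640 * ?m + 180"
      by (simp add: q_def algebra_simps)
    then have "k \<le> 160 * q + 40 * K + 640 * ?m + 180" using k(2) by (simp add: K_def)
    ultimately have "13 + k \<le> 1100 * q" by linarith
    then show ?thesis using False cardB by (simp add: q_def K_def)
  qed
  have out: "ram_output t = (if fst s 1 = 0 then ereal (real (fst s 0)) else \<infinity>)"
    using k(3) by (simp add: ram_output_def represents_def)
  have dist: "dist_in G a b = (INF k\<in>{k. (a, b) \<in> set es ^^ k}. ereal (real k))" if "a \<in> S" for a b
    using dist_in_eq[OF G.pair_wf_digraph_axioms, of a b] S that es by auto
  have "ereal (2 / 3) * ST_diameter G S T \<le> ram_output t \<and> ram_output t \<le> ST_diameter G S T"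
  proof (cases "fst s 1 = 0")
    case True
    obtain a b where ab: "a \<in> S" "b \<in> T" "\<forall>k. (a, b) \<in> set es ^^ k \<longrightarrow> fst s 0 \<le> k"
      using k(4) True by (auto simp: correct_def)
    have "ereal (real (fst s 0)) \<le> dist_in G a b"
      unfolding dist[OF ab(1)] using ab(3) by (intro INF_greatest) simp
    also have "\<dots> \<le> ST_diameter G S T" using fin ab by (intro ST_diameter_ge)
    finally have upper: "ram_output t \<le> ST_diameter G S T" using out True by simp
    obtain a b where ab: "a \<in> S" "b \<in> T" "ST_diameter G S T = dist_in G a b"
      using ST_diameter_attained[OF fin ne] by metis
    have "\<forall>a\<in>S. \<forall>b\<in>T. \<exists>k. (a, b) \<in> set es ^^ k \<and> 2 * k \<le> 3 * fst s 0"
      using k(4) True by (simp add: correct_def)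
    then obtain k where k: "(a, b) \<in> set es ^^ k" "2 * k \<le> 3 * fst s 0"
      using ab(1,2) by blast
    have "ST_diameter G S T \<le> ereal (real k)"
      unfolding ab(3) dist[OF ab(1)] using k by (intro INF_lower) simp
    then have "ereal (2 / 3) * ST_diameter G S T \<le> ereal (2 / 3) * ereal (real k)"
      by (intro ereal_mult_left_mono) simp_all
    also have "\<dots> \<le> ereal (real (fst s 0))" using k(2) by simp
    finally show ?thesis using upper out True by simp
  next
    case False
    then obtain a b where ab: "a \<in> S" "b \<in> T" "\<forall>k. (a, b) \<notin> set es ^^ k"
      using k(4) by (auto simp: correct_def)
    then have "dist_in G a b = \<infinity>" unfolding dist[OF ab(1)] by (simp add: top_ereal_def)
    then have "ST_diameter G S T = \<infinity>" using ST_diameter_ge[OF fin ab(1,2), of G] by simp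
    then show ?thesis using out False by simp
  qed
  then show "let m = card (parcs G); B' = boundary G S T in
       \<exists>k s. ram_exec w (Seq preamble (compile main)) (ram_init (encode_input n es S)) k s \<and>
             k \<le> 1100 * (if B' = {} then m + 1 else m * card B') \<and>
             ereal (2 / 3) * ST_diameter G S T \<le> ram_output s \<and>
             ram_output s \<le> ST_diameter G S T"
    unfolding Let_def m using exec time by blast
qed

end
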